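(* The following lower bounds hold for geodesic spanners in simple polygons. For every constant $\varepsilon\in(0,1)$ and every integer constant $t\ge 2$ there are constants $c,C>0$ such that for all positive integers $n,m,k$ with $m\ge Cn$: (1) if $k<n/2$, there are a simple polygon $P$ with $m$ vertices and a set $S$ of $n$ point sites in $P$ such that every geodesic $(2-\varepsilon)$-spanner for $S$ using $k$ Steiner points has complexity at least $c\,mn^2/k^2$; (2) if $k<n/2$, there are a simple polygon $P$ with $m$ vertices and a set $S$ of $n$ point sites in $P$ such that every geodesic $(3-\varepsilon)$-spanner for $S$ using $k$ Steiner points has complexity at least $c\,mn/k$; (3) if $k<n$, there are a simple polygon $P$ with $m$ vertices and a set $S$ of $n$ point sites in $P$ such that every geodesic $(t-\varepsilon)$-spanner for $S$ using $k$ Steiner points has complexity at least $c\,mn^{1/(t+1)}/k^{1/(t+1)}$.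
   Context: For points $p,q\in P$, $d(p,q)$ is the geodesic distance, i.e. the length of the shortest path $\pi(p,q)$ between $p$ and $q$ contained in $P$. A geodesic spanner with Steiner point set $\mathcal{S}\subset P$ is a graph $\mathcal{G}$ with vertex set $S\cup\mathcal{S}$; its edges are called links. A link $(p,q)$ is the shortest path $\pi(p,q)$ in $P$: its length is $d(p,q)$ and its complexity is the number of line segments of $\pi(p,q)$. $\mathcal{G}$ is a $\tau$-spanner if $d_{\mathcal{G}}(p,q)\le \tau\, d(p,q)$ for all sites $p,q\in S$, where $d_{\mathcal G}$ is the shortest-path distance in $\mathcal{G}$ (no requirement is made for distances involving Steiner points). The complexity of $\mathcal{G}$ is the sum of the complexities of its links (a segment occurring in several links is counted once for each). *)

theory Defs
  imports "HOL-Analysis.Analysis"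
begin

text \<open>The Euclidean plane is the type \<^typ>\<open>complex\<close>, as in the library's Jordan curve theorem.\<close>

subsection \<open>Simple polygons\<close>

definition polygon_edge :: "complex list \<Rightarrow> nat \<Rightarrow> complex set" where
  "polygon_edge vs i = closed_segment (vs ! i) (vs ! (Suc i mod length vs))"

definition polygon_boundary :: "complex list \<Rightarrow> complex set" where
  "polygon_boundary vs = (\<Union>i<length vs. polygon_edge vs i)"

text \<open>
  The vertices are listed in cyclic order. The second condition says that two different edges meet
  at most in their common endpoints. By the third one every listed point is a genuine corner, so
  that \<^term>\<open>length vs\<close> is the number of vertices of the region and cannot be increased by
  subdividing edges.
\<close>
definition simple_polygon :: "complex list \<Rightarrow> bool" where
  "simple_polygon vs \<longleftrightarrow>
     length vs \<ge> 3 \<and> distinct vs \<and>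
     (\<forall>i<length vs. \<forall>j<length vs. i \<noteq> j \<longrightarrow>
        polygon_edge vs i \<inter> polygon_edge vs j =
          {vs ! i, vs ! (Suc i mod length vs)} \<inter> {vs ! j, vs ! (Suc j mod length vs)}) \<and>
     (\<forall>i<length vs.
        \<not> collinear {vs ! i, vs ! (Suc i mod length vs), vs ! (Suc (Suc i) mod length vs)})"

definition polygon_region :: "complex list \<Rightarrow> complex set" where
  "polygon_region vs = polygon_boundary vs \<union> inside (polygon_boundary vs)"

subsection \<open>Shortest paths\<close>

definition curve_length :: "(real \<Rightarrow> complex) \<Rightarrow> ennreal" where
  "curve_length g =
     (SUP ts \<in> {ts. sorted ts \<and> set ts \<subseteq> {0..1}}.
        \<Sum>i<length ts - 1. ennreal (dist (g (ts ! i)) (g (ts ! Suc i))))"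

definition paths_in :: "complex set \<Rightarrow> complex \<Rightarrow> complex \<Rightarrow> (real \<Rightarrow> complex) set" where
  "paths_in P p q = {g. path g \<and> path_image g \<subseteq> P \<and> pathstart g = p \<and> pathfinish g = q}"

definition geodesic_dist :: "complex set \<Rightarrow> complex \<Rightarrow> complex \<Rightarrow> ennreal" where
  "geodesic_dist P p q = (INF g \<in> paths_in P p q. curve_length g)"

definition shortest_path :: "complex set \<Rightarrow> complex \<Rightarrow> complex \<Rightarrow> (real \<Rightarrow> complex) \<Rightarrow> bool" where
  "shortest_path P p q g \<longleftrightarrow> g \<in> paths_in P p q \<and> curve_length g = geodesic_dist P p q"

text \<open>The polygonal curve through a nonempty list of points; it has one segment less than points.\<close>
fun polygonal_path :: "complex list \<Rightarrow> real \<Rightarrow> complex" where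
  "polygonal_path [] = linepath 0 0"
| "polygonal_path [x] = linepath x x"
| "polygonal_path [x, y] = linepath x y"
| "polygonal_path (x # y # z # xs) = linepath x y +++ polygonal_path (y # z # xs)"

text \<open>
  The number of segments of the shortest path, where collinear consecutive segments count as one
  (hence the infimum over all ways of writing it as a polygonal curve). In a simple polygon the
  shortest path exists, is unique up to parametrisation and is polygonal, so the infimum is
  attained; the value \<^term>\<open>\<infinity> :: enat\<close> only occurs for other sets.
\<close>
definition geodesic_complexity :: "complex set \<Rightarrow> complex \<Rightarrow> complex \<Rightarrow> enat" where
  "geodesic_complexity P p q =
     (INF xs \<in> {xs. xs \<noteq> [] \<and> shortest_path P p q (polygonal_path xs)}. enat (length xs - 1))"

subsection \<open>Geodesic spanners\<close>

text \<open>
  A link is an unordered pair of distinct points. The infimum below ranges over the two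
  orientations of the link, which have the same complexity.
\<close>
definition link_complexity :: "complex set \<Rightarrow> complex set \<Rightarrow> enat" where
  "link_complexity P e = (INF (p, q) \<in> {(p, q). e = {p, q}}. geodesic_complexity P p q)"

definition complexity :: "complex set \<Rightarrow> complex set set \<Rightarrow> enat" where
  "complexity P E = (\<Sum>e\<in>E. link_complexity P e)"

definition walks :: "complex set set \<Rightarrow> complex \<Rightarrow> complex \<Rightarrow> complex list set" where
  "walks E p q =
     {ws. ws \<noteq> [] \<and> hd ws = p \<and> last ws = q \<and> (\<forall>i<length ws - 1. {ws ! i, ws ! Suc i} \<in> E)}"

definition graph_dist :: "complex set \<Rightarrow> complex set set \<Rightarrow> complex \<Rightarrow> complex \<Rightarrow> ennreal" where
  "graph_dist P E p q =
     (INF ws \<in> walks E p q. \<Sum>i<length ws - 1. geodesic_dist P (ws ! i) (ws ! Suc i))"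

text \<open>\<open>S\<close> are the sites, \<open>T\<close> the Steiner points, \<open>E\<close> the links and \<open>\<tau>\<close> the spanning ratio.\<close>
definition geodesic_spanner ::
    "complex set \<Rightarrow> complex set \<Rightarrow> complex set \<Rightarrow> complex set set \<Rightarrow> real \<Rightarrow> bool" where
  "geodesic_spanner P S T E \<tau> \<longleftrightarrow>
     finite S \<and> finite T \<and> S \<subseteq> P \<and> T \<subseteq> P \<and>
     E \<subseteq> {{u, v} | u v. u \<in> S \<union> T \<and> v \<in> S \<union> T \<and> u \<noteq> v} \<and>
     (\<forall>p\<in>S. \<forall>q\<in>S. graph_dist P E p q \<le> ennreal \<tau> * geodesic_dist P p q)"

text \<open>
  Some simple polygon with \<open>m\<close> vertices and \<open>n\<close> sites in it force complexity at least \<open>b\<close> on every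
  geodesic \<open>\<tau>\<close>-spanner with \<open>k\<close> Steiner points.
\<close>
definition spanner_lower_bound :: "nat \<Rightarrow> nat \<Rightarrow> nat \<Rightarrow> real \<Rightarrow> real \<Rightarrow> bool" where
  "spanner_lower_bound n m k \<tau> b \<longleftrightarrow>
     (\<exists>vs S. simple_polygon vs \<and> length vs = m \<and>
        finite S \<and> card S = n \<and> S \<subseteq> polygon_region vs \<and>
        (\<forall>T E. geodesic_spanner (polygon_region vs) S T E \<tau> \<and> card T = k \<longrightarrow>
           ereal b \<le> ereal_of_enat (complexity (polygon_region vs) E)))"

end

theory Submission
  imports Defs
begin

text \<open>
  The polygon is a zigzag corridor between two piecewise linear functions whose nodes lie
  alternately below and above the real axis, so that a segment inside it covers at most two nodes
  and a path has at least half as many segments as the number of nodes that it passes. The sites are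
  the tips of spikes of the same large height \<open>H\<close>, regularly spaced along the corridor and grouped
  into \<open>2k\<close> blocks of about \<open>n/2k\<close> sites that are separated by very deep pits. All sites of a block are
  at distance about \<open>2H\<close> from each other, and leaving a block is too expensive. Hence at least \<open>k\<close>
  blocks contain no Steiner point, and in these a \<open>(t - \<epsilon>)\<close>-spanner connects any two sites by at most
  \<open>t - 1\<close> links between sites of the block. What remains is a lower bound for the total length of the
  edges of a graph of small hop diameter on consecutive integers. If \<open>n < 4k\<close>, it is enough that the
  spanner is connected and so passes every node.
\<close>

section \<open>Graphs of small hop diameter on an interval of integers\<close>

text \<open>Steiner points are the obstacle: one at the foot of the spikes would halve the price of
  a link. Hence there are twice as many blocks as Steiner points, and descending into a pit alone
  exceeds the length allowed for a walk between two sites of a block. The height \<open>H\<close>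
  turns the spanning ratio into a hop count: a link between two sites costs at least
  \<open>2 * H\<close>, and inside a block their distance is at most \<open>2 * H + 4 * q\<close>
  with \<open>q\<close> the width of the block, so \<open>t\<close> links are too expensive once
  \<open>\<epsilon> * H\<close> dominates \<open>t * q\<close>. No shortest path is ever computed:
  lower bounds on distances come from a vertical line that must be crossed, upper bounds from an
  explicit curve, and complexity from the nodes passed by an arbitrary polygonal path. The bound is
  a product: index distance \<open>d\<close> means \<open>2 * z * d\<close> nodes with
  \<open>z\<close> of order \<open>m / n\<close>, and each of \<open>k\<close> free blocks has total
  index length of order \<open>(n / k) powr \<beta>\<close> at least, which together give
  \<open>m * (n / k) powr (\<beta> - 1)\<close>. The three claims are \<open>\<beta> = 3\<close>,
  \<open>\<beta> = 2\<close> and \<open>\<beta> = 1 + 1 / (t + 1)\<close>.\<close>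

definition total_length :: "(nat \<times> nat) set \<Rightarrow> real" where
  "total_length A = (\<Sum>(i, j)\<in>A. \<bar>real i - real j\<bar>)"

definition hop_diameter_le :: "nat set \<Rightarrow> (nat \<times> nat) set \<Rightarrow> nat \<Rightarrow> bool" where
  "hop_diameter_le V A h \<longleftrightarrow> A \<subseteq> V \<times> V \<and> (\<forall>i\<in>V. \<forall>j\<in>V. \<exists>d\<le>h. (i, j) \<in> A ^^ d)"

lemma total_length_mono:
  assumes "finite A" "B \<subseteq> A"
  shows "total_length B \<le> total_length A"
  unfolding total_length_def using assms by (intro sum_mono2) auto

text \<open>One long edge is chosen per start vertex; different start vertices give different
  ordered pairs, so nothing is counted twice.\<close>

lemma card_long_edges:
  fixes r :: real
  assumes "finite A" "0 < r"
    and long: "\<And>i. i \<in> L \<Longrightarrow> \<exists>j. (i, j) \<in> A \<and> r \<le> \<bar>real i - real j\<bar>"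
  shows "real (card L) * r \<le> total_length A"
proof -
  obtain e where e: "\<And>i. i \<in> L \<Longrightarrow> (i, e i) \<in> A \<and> r \<le> \<bar>real i - real (e i)\<bar>"
    using long by metis
  have inj: "inj_on (\<lambda>i. (i, e i)) L"
    by (auto simp: inj_on_def)
  have "real (card L) * r = (\<Sum>i\<in>L. r)"
    by simp
  also have "\<dots> \<le> (\<Sum>i\<in>L. \<bar>real i - real (e i)\<bar>)"
    using e by (intro sum_mono) auto
  also have "\<dots> = total_length ((\<lambda>i. (i, e i)) ` L)"
    unfolding total_length_def by (subst sum.reindex[OF inj]) simp
  also have "\<dots> \<le> total_length A"
    using e assms(1) by (intro total_length_mono) auto
  finally show ?thesis .
qed

text \<open>The outer thirds of an interval, rounded up so that both are nonempty already for
  \<open>s = 2\<close>. Rounding leaves a guaranteed gap of \<open>(s - 1) / 3\<close>, which is at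
  least \<open>s / 6\<close> as soon as \<open>s \<ge> 2\<close>.\<close>

lemma card_thirds:
  fixes l s :: nat
  defines "L \<equiv> {i. l \<le> i \<and> 3 * (i - l) < s}" and "R \<equiv> {i. i < l + s \<and> 3 * (l + s - 1 - i) < s}"
  assumes "2 \<le> s"
  shows "real s / 3 \<le> real (card L)" "real s / 3 \<le> real (card R)"
    "L \<subseteq> {l..<l + s}" "R \<subseteq> {l..<l + s}"
    "\<forall>i\<in>L. \<forall>j\<in>R. i < j \<and> real s / 6 \<le> real j - real i"
proof -
  define c where "c = (s + 2) div 3"
  have c: "s \<le> 3 * c" "3 * c \<le> s + 2"
    unfolding c_def by auto
  have "L = {l..<l + c}"
    unfolding L_def c_def by auto
  then show "real s / 3 \<le> real (card L)"
    using c by simp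
  have "R = {l + s - c..<l + s}"
    unfolding R_def c_def using \<open>2 \<le> s\<close> by auto
  moreover have "c \<le> s" using c \<open>2 \<le> s\<close> by linarith
  ultimately show "real s / 3 \<le> real (card R)"
    using c by simp
  show "L \<subseteq> {l..<l + s}" "R \<subseteq> {l..<l + s}"
    unfolding L_def R_def using \<open>2 \<le> s\<close> by auto
  show "\<forall>i\<in>L. \<forall>j\<in>R. i < j \<and> real s / 6 \<le> real j - real i"
  proof (intro ballI)
    fix i j assume that: "i \<in> L" "j \<in> R"
    have *: "l \<le> i" "3 * (i - l) < s" "j < l + s" "3 * (l + s - 1 - j) < s"
      using that unfolding L_def R_def by auto
    then have "3 * i + s \<le> 3 * j + 1" "i < j"
      using \<open>2 \<le> s\<close> by linarith+
    then have "real (3 * i + s) \<le> real (3 * j + 1)"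
      by (simp only: of_nat_le_iff)
    then have "real s - 1 \<le> 3 * (real j - real i)"
      by simp
    then have "real s / 6 \<le> real j - real i"
      using \<open>2 \<le> s\<close> by (simp add: field_simps)
    then show "i < j \<and> real s / 6 \<le> real j - real i"
      using \<open>i < j\<close> by blast
  qed
qed

text \<open>All pairs between the outer thirds must be edges: at least \<open>(s / 3) ^ 2\<close> of
  them, each of length at least \<open>s / 6\<close>.\<close>

lemma total_length_hop1:
  assumes "hop_diameter_le {l..<l + s} A 1" "2 \<le> s"
  shows "real s ^ 3 / 54 \<le> total_length A"
proof -
  define L R where "L = {i. l \<le> i \<and> 3 * (i - l) < s}" and "R = {i. i < l + s \<and> 3 * (l + s - 1 - i) < s}"
  note thirds = card_thirds[OF \<open>2 \<le> s\<close>, of l, folded L_def R_def]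
  have A: "A \<subseteq> {l..<l + s} \<times> {l..<l + s}"
    using assms unfolding hop_diameter_le_def by auto
  then have finA: "finite A"
    by (rule finite_subset) auto
  have sub: "L \<times> R \<subseteq> A"
  proof clarify
    fix i j assume ij: "i \<in> L" "j \<in> R"
    then have "i \<noteq> j" "i \<in> {l..<l + s}" "j \<in> {l..<l + s}"
      using thirds(3,4) thirds(5) ij by fastforce+
    then obtain d where "d \<le> 1" "(i, j) \<in> A ^^ d"
      using assms unfolding hop_diameter_le_def by blast
    with \<open>i \<noteq> j\<close> show "(i, j) \<in> A"
      by (cases d) auto
  qed
  have "real s ^ 3 / 54 = (real s / 3) * (real s / 3) * (real s / 6)"
    by (simp add: power3_eq_cube)
  also have "\<dots> \<le> real (card L) * real (card R) * (real s / 6)"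
    using thirds(1,2) by (intro mult_right_mono mult_mono) auto
  also have "\<dots> = (\<Sum>p\<in>L \<times> R. real s / 6)"
    by (simp add: card_cartesian_product)
  also have "\<dots> \<le> total_length (L \<times> R)"
    unfolding total_length_def using thirds(5) by (intro sum_mono) force
  also have "\<dots> \<le> total_length A"
    using finA sub by (rule total_length_mono)
  finally show ?thesis .
qed

text \<open>If some vertex of the left third and some vertex of the right third both had only edges
  shorter than \<open>s / 12\<close>, two hops could not bridge the gap \<open>s / 6\<close>. So in
  one of the thirds every vertex starts a long edge.\<close>

lemma total_length_hop2:
  assumes "hop_diameter_le {l..<l + s} A 2" "2 \<le> s" "sym A"
  shows "real s ^ 2 / 36 \<le> total_length A"
proof -
  define L R where "L = {i. l \<le> i \<and> 3 * (i - l) < s}" and "R = {i. i < l + s \<and> 3 * (l + s - 1 - i) < s}"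
  note thirds = card_thirds[OF \<open>2 \<le> s\<close>, of l, folded L_def R_def]
  have A: "A \<subseteq> {l..<l + s} \<times> {l..<l + s}"
    using assms unfolding hop_diameter_le_def by auto
  then have finA: "finite A"
    by (rule finite_subset) auto
  define lng where "lng i \<longleftrightarrow> (\<exists>j. (i, j) \<in> A \<and> real s / 12 \<le> \<bar>real i - real j\<bar>)" for i
  have either: "lng i \<or> lng j" if ij: "i \<in> L" "j \<in> R" for i j
  proof -
    have d6: "real s / 6 \<le> real j - real i" "i < j"
      using thirds(5) ij by auto
    have "i \<in> {l..<l + s}" "j \<in> {l..<l + s}"
      using thirds(3,4) ij by auto
    then obtain d where d: "d \<le> 2" "(i, j) \<in> A ^^ d"
      using assms unfolding hop_diameter_le_def by blast
    consider "d = 0" | "d = 1" | "d = 2"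
      using d(1) by linarith
    then show ?thesis
    proof cases
      case 1
      then show ?thesis using d d6 by auto
    next
      case 2
      then have "(i, j) \<in> A" using d by auto
      then show ?thesis unfolding lng_def using d6 by force
    next
      case 3
      then obtain w where w: "(i, w) \<in> A" "(w, j) \<in> A"
        using d by (auto simp: numeral_2_eq_2)
      \<comment> \<open>Symmetry turns the second hop into an edge that starts at \<open>j\<close>,
        as the count per start vertex requires.\<close>
      then have "(j, w) \<in> A" using \<open>sym A\<close> by (auto dest: symD)
      moreover have "real s / 12 \<le> \<bar>real i - real w\<bar> \<or> real s / 12 \<le> \<bar>real j - real w\<bar>"
        using d6 by linarith
      ultimately show ?thesis using w unfolding lng_def by blast
    qed
  qed
  have "(\<forall>i\<in>L. lng i) \<or> (\<forall>j\<in>R. lng j)"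
    using either by blast
  then obtain X where X: "real s / 3 \<le> real (card X)" "\<And>i. i \<in> X \<Longrightarrow> lng i"
    using thirds(1,2) by blast
  have "real s ^ 2 / 36 = (real s / 3) * (real s / 12)"
    by (simp add: power2_eq_square)
  also have "\<dots> \<le> real (card X) * (real s / 12)"
    using X(1) by (intro mult_right_mono) auto
  also have "\<dots> \<le> total_length A"
    using X(2) \<open>2 \<le> s\<close> finA unfolding lng_def by (intro card_long_edges) auto
  finally show ?thesis .
qed

lemma card_nat_ball:
  fixes r :: real
  assumes "0 \<le> r"
  shows "finite {u::nat. \<bar>real u - real w\<bar> \<le> r}" "real (card {u::nat. \<bar>real u - real w\<bar> \<le> r}) \<le> 2 * r + 1"
proof -
  define c where "c = nat \<lfloor>r\<rfloor>"
  have "{u::nat. \<bar>real u - real w\<bar> \<le> r} \<subseteq> {w - c..w + c}"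
    unfolding c_def by (auto simp: le_nat_floor) linarith+
  moreover have "card {w - c..w + c} \<le> 2 * c + 1"
    by auto
  ultimately show "finite {u::nat. \<bar>real u - real w\<bar> \<le> r}"
    "real (card {u::nat. \<bar>real u - real w\<bar> \<le> r}) \<le> 2 * r + 1"
  proof -
    show "finite {u::nat. \<bar>real u - real w\<bar> \<le> r}"
      using \<open>_ \<subseteq> _\<close> by (rule finite_subset) simp
    have "card {u::nat. \<bar>real u - real w\<bar> \<le> r} \<le> 2 * c + 1"
      using card_mono[OF _ \<open>_ \<subseteq> _\<close>] \<open>card {w - c..w + c} \<le> _\<close> by fastforce
    moreover have "real c \<le> r"
      unfolding c_def using assms by simp
    ultimately show "real (card {u::nat. \<bar>real u - real w\<bar> \<le> r}) \<le> 2 * r + 1"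
      by linarith
  qed
qed

text \<open>
  Call \<open>u\<close> bad at level \<open>i\<close> if an edge longer than \<open>\<rho>\<^sup>i\<^sup>+\<^sup>1 - \<rho>\<^sup>i\<close> starts within distance \<open>\<rho>\<^sup>i\<close>
  of \<open>u\<close>. From a vertex that is bad at no level, \<open>i\<close> hops lead no farther than \<open>\<rho>\<^sup>i\<close>.
\<close>
lemma total_length_radii:
  assumes hop: "hop_diameter_le {l..<l + s} A h" and "2 \<le> \<rho>" "\<rho> ^ h < (real s - 1) / 2"
  shows "real s * \<rho> \<le> 6 * real h * total_length A"
proof (rule ccontr)
  assume small: "\<not> ?thesis"
  have A: "A \<subseteq> {l..<l + s} \<times> {l..<l + s}"
    using hop unfolding hop_diameter_le_def by auto
  then have finA: "finite A"
    by (rule finite_subset) auto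
  define lng where
    "lng i = {w. \<exists>j. (w, j) \<in> A \<and> \<rho> ^ Suc i - \<rho> ^ i \<le> \<bar>real w - real j\<bar>}" for i
  define bad where "bad i = (\<Union>w\<in>lng i. {u. \<bar>real u - real w\<bar> \<le> \<rho> ^ i})" for i
  have fin_lng: "finite (lng i)" for i
    by (rule finite_subset[of _ "fst ` A"]) (use finA in \<open>force simp: lng_def\<close>)+
  have fin_bad: "finite (bad i)" for i
    unfolding bad_def using fin_lng card_nat_ball(1)[of "\<rho> ^ i"] \<open>2 \<le> \<rho>\<close> by auto
  \<comment> \<open>The level cancels: a ball of radius \<open>\<rho> ^ i\<close> has at most
    \<open>3 * \<rho> ^ i\<close> points, and each long edge behind \<open>lng i\<close> has length
    at least \<open>\<rho> ^ Suc i / 2\<close>.\<close>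
  have card_bad: "real (card (bad i)) * \<rho> \<le> 6 * total_length A" for i
  proof -
    have pos: "1 \<le> \<rho> ^ i"
      using \<open>2 \<le> \<rho>\<close> by simp
    have half: "\<rho> ^ i * \<rho> \<le> 2 * (\<rho> ^ Suc i - \<rho> ^ i)"
      using mult_right_mono[of 2 \<rho> "\<rho> ^ i"] \<open>2 \<le> \<rho>\<close> pos by (simp add: algebra_simps)
    have gap: "0 < \<rho> ^ Suc i - \<rho> ^ i"
      using half mult_pos_pos[of "\<rho> ^ i" \<rho>] \<open>2 \<le> \<rho>\<close> pos by auto
    have "real (card (bad i)) \<le> (\<Sum>w\<in>lng i. real (card {u. \<bar>real u - real w\<bar> \<le> \<rho> ^ i}))"
      unfolding bad_def of_nat_sum[symmetric] of_nat_le_iff by (intro card_UN_le fin_lng)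
    also have "\<dots> \<le> (\<Sum>w\<in>lng i. 3 * \<rho> ^ i)"
    proof (rule sum_mono)
      fix w
      show "real (card {u. \<bar>real u - real w\<bar> \<le> \<rho> ^ i}) \<le> 3 * \<rho> ^ i"
        using card_nat_ball(2)[of "\<rho> ^ i" w] pos by linarith
    qed
    also have "\<dots> = 3 * \<rho> ^ i * real (card (lng i))"
      by simp
    finally have "real (card (bad i)) * \<rho> \<le> 3 * \<rho> ^ i * real (card (lng i)) * \<rho>"
      using \<open>2 \<le> \<rho>\<close> by (intro mult_right_mono) auto
    also have "\<dots> = 3 * real (card (lng i)) * (\<rho> ^ i * \<rho>)"
      by simp
    also have "\<dots> \<le> 3 * real (card (lng i)) * (2 * (\<rho> ^ Suc i - \<rho> ^ i))"
      using half by (intro mult_left_mono) auto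
    also have "\<dots> = 6 * (real (card (lng i)) * (\<rho> ^ Suc i - \<rho> ^ i))"
      by simp
    also have "\<dots> \<le> 6 * total_length A"
      by (intro mult_left_mono card_long_edges finA gap) (auto simp: lng_def)
    finally show ?thesis .
  qed
  have "real (card (\<Union>i<h. bad i)) * \<rho> \<le> (\<Sum>i<h. real (card (bad i))) * \<rho>"
    using \<open>2 \<le> \<rho>\<close> unfolding of_nat_sum[symmetric]
    by (intro mult_right_mono of_nat_mono card_UN_le) auto
  also have "\<dots> \<le> (\<Sum>i<h. 6 * total_length A)"
    unfolding sum_distrib_right by (intro sum_mono card_bad)
  also have "\<dots> < real s * \<rho>"
    using small by simp
  finally have "card (\<Union>i<h. bad i) < card {l..<l + s}"
    using \<open>2 \<le> \<rho>\<close> by simp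
  then have "\<not> {l..<l + s} \<subseteq> (\<Union>i<h. bad i)"
    using card_mono[of "\<Union>i<h. bad i" "{l..<l + s}"] fin_bad by (metis finite_UN_I finite_lessThan leD)
  then obtain u where u: "u \<in> {l..<l + s}" "\<And>i. i < h \<Longrightarrow> u \<notin> bad i"
    by blast
  have near: "\<bar>real u - real v\<bar> \<le> \<rho> ^ i" if "i \<le> h" "(u, v) \<in> A ^^ i" for i v
    using that
  proof (induction i arbitrary: v)
    case 0
    then show ?case by simp
  next
    case (Suc i)
    then obtain w where w: "(u, w) \<in> A ^^ i" "(w, v) \<in> A"
      by auto
    then have uw: "\<bar>real u - real w\<bar> \<le> \<rho> ^ i"
      using Suc by simp
    then have "w \<notin> lng i"
      using u(2)[of i] Suc.prems(1) unfolding bad_def by auto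
    then have "\<bar>real w - real v\<bar> < \<rho> ^ Suc i - \<rho> ^ i"
      using w(2) unfolding lng_def by force
    then show ?case
      using uw by linarith
  qed
  have far: False if v: "v \<in> {l..<l + s}" "(real s - 1) / 2 \<le> \<bar>real u - real v\<bar>" for v
  proof -
    obtain i where i: "i \<le> h" "(u, v) \<in> A ^^ i"
      using hop u(1) v(1) unfolding hop_diameter_le_def by blast
    have "\<bar>real u - real v\<bar> \<le> \<rho> ^ i"
      using near i by blast
    also have "\<dots> \<le> \<rho> ^ h"
      using i(1) \<open>2 \<le> \<rho>\<close> by (intro power_increasing) auto
    finally show False
      using v(2) assms(3) by linarith
  qed
  have s: "0 < s" using u(1) by simp
  \<comment> \<open>One end of the interval is at distance at least \<open>(s - 1) / 2\<close> from
    \<open>u\<close>, beyond the reach \<open>\<rho> ^ h\<close>.\<close>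
  show False
  proof (cases "real u - real l \<le> (real s - 1) / 2")
    case True
    then show False
      using far[of "l + s - 1"] s by (cases s) auto
  next
    case False
    then show False
      using far[of l] u(1) s by auto
  qed
qed

text \<open>Radii with \<open>\<rho> ^ h = s / 5\<close> yield the exponent
  \<open>1 + 1 / h\<close>. The smaller \<open>1 + 1 / (h + 2)\<close> is kept, which for
  \<open>h = t - 1\<close> is the one of the third claim.\<close>

lemma total_length_hop:
  fixes h :: nat
  assumes "1 \<le> h"
  shows "\<exists>c>0. \<forall>l s A. hop_diameter_le {l..<l + s} A h \<longrightarrow> 2 \<le> s \<longrightarrow>
           c * real s powr (1 + 1 / real (h + 2)) \<le> total_length A"
proof -
  \<comment> \<open>From \<open>K\<close> on, \<open>\<rho>\<close> is at least 2. Below it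
    \<open>s\<close> is bounded and a single edge of length 1 suffices, hence the term
    \<open>1 / K ^ 2\<close> in \<open>c\<close>. The 5 ensures \<open>s / 5 < (s - 1) / 2\<close>
    from \<open>s = 2\<close> on.\<close>
  define K :: nat where "K = 5 * 2 ^ h"
  define c where "c = min (1 / real K ^ 2) ((1 / 5) powr (1 / real h) / (6 * real h))"
  have K: "0 < K" unfolding K_def by simp
  have "c > 0" unfolding c_def using assms K by simp
  moreover have "c * real s powr (1 + 1 / real (h + 2)) \<le> total_length A"
    if hop: "hop_diameter_le {l..<l + s} A h" and "2 \<le> s" for l s A
  proof (cases "K \<le> s")
    case True
    define \<rho> where "\<rho> = (real s / 5) powr (1 / real h)"
    have \<rho>h: "\<rho> ^ h = real s / 5"
      unfolding \<rho>_def using assms \<open>2 \<le> s\<close> by (simp add: powr_power)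
    have "2 ^ h \<le> \<rho> ^ h"
    proof -
      have "real K \<le> real s" using True by simp
      then show ?thesis unfolding \<rho>h K_def by simp
    qed
    then have "2 \<le> \<rho>"
      using power_mono_iff[of 2 \<rho> h] assms unfolding \<rho>_def by simp
    moreover have "\<rho> ^ h < (real s - 1) / 2"
      unfolding \<rho>h using \<open>2 \<le> s\<close> by simp
    ultimately have main: "real s * \<rho> \<le> 6 * real h * total_length A"
      using total_length_radii[OF hop] by blast
    have "real s powr (1 + 1 / real (h + 2)) \<le> real s powr (1 + 1 / real h)"
      using assms \<open>2 \<le> s\<close> by (intro powr_mono) (auto simp: field_simps)
    also have "\<dots> = real s * real s powr (1 / real h)"
      using \<open>2 \<le> s\<close> by (simp add: powr_add)
    finally have "c * real s powr (1 + 1 / real (h + 2)) \<le>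
        (1 / 5) powr (1 / real h) / (6 * real h) * (real s * real s powr (1 / real h))"
      by (intro mult_mono) (auto simp: c_def)
    also have "\<dots> = real s * \<rho> / (6 * real h)"
      unfolding \<rho>_def by (simp add: powr_divide powr_mult)
    also have "\<dots> \<le> total_length A"
      using main assms by (simp add: field_simps)
    finally show ?thesis .
  next
    case False
    have A: "A \<subseteq> {l..<l + s} \<times> {l..<l + s}"
      using hop unfolding hop_diameter_le_def by auto
    then have finA: "finite A"
      by (rule finite_subset) auto
    obtain d where d: "(l, l + 1) \<in> A ^^ d"
      using hop \<open>2 \<le> s\<close> unfolding hop_diameter_le_def by fastforce
    have "\<exists>i j. (i, j) \<in> A \<and> i \<noteq> j"
    proof (rule ccontr)
      assume "\<not> ?thesis"
      then have "A \<subseteq> Id" by auto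
      then have "A ^^ d \<subseteq> Id"
        by (induction d) auto
      then show False using d by auto
    qed
    then obtain i j where ij: "(i, j) \<in> A" "i \<noteq> j" by blast
    then have "1 \<le> \<bar>real i - real j\<bar>" by linarith
    then have one: "1 \<le> total_length A"
      using card_long_edges[of A 1 "{i}"] ij(1) finA by auto
    have "1 + 1 / real (h + 2) \<le> 2" by (simp add: field_simps)
    then have "real s powr (1 + 1 / real (h + 2)) \<le> real s powr 2"
      using \<open>2 \<le> s\<close> by (intro powr_mono) auto
    also have "\<dots> = real s ^ 2"
      using \<open>2 \<le> s\<close> powr_realpow[of "real s" 2] by simp
    also have "\<dots> \<le> real K ^ 2"
      using False by (intro power_mono) auto
    finally have "c * real s powr (1 + 1 / real (h + 2)) \<le> 1 / real K ^ 2 * real K ^ 2"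
      by (intro mult_mono) (auto simp: c_def)
    also have "\<dots> = 1" using K by simp
    finally show ?thesis using one by linarith
  qed
  ultimately show ?thesis by blast
qed

lemma total_length_sym:
  assumes "finite A" "sym A"
  shows "total_length A = 2 * (\<Sum>(i, j)\<in>{(i, j) \<in> A. i < j}. real j - real i)"
proof -
  define A1 A2 A3 where "A1 = {(i, j) \<in> A. i < j}" and "A2 = {(i, j) \<in> A. j < i}"
    and "A3 = {(i, j) \<in> A. i = j}"
  have A: "A = A1 \<union> A2 \<union> A3" "A1 \<inter> A2 = {}" "(A1 \<union> A2) \<inter> A3 = {}"
    unfolding A1_def A2_def A3_def by auto
  have fin: "finite A1" "finite A2" "finite A3"
    using assms(1) A(1) by (metis finite_Un)+
  have "total_length A = (\<Sum>(i, j)\<in>A1. \<bar>real i - real j\<bar>) + (\<Sum>(i, j)\<in>A2. \<bar>real i - real j\<bar>)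
      + (\<Sum>(i, j)\<in>A3. \<bar>real i - real j\<bar>)"
    unfolding total_length_def by (subst A(1)) (simp add: sum.union_disjoint fin A)
  also have "(\<Sum>(i, j)\<in>A3. \<bar>real i - real j\<bar>) = 0"
    unfolding A3_def by (intro sum.neutral) auto
  also have "(\<Sum>(i, j)\<in>A1. \<bar>real i - real j\<bar>) = (\<Sum>(i, j)\<in>A1. real j - real i)"
    unfolding A1_def by (intro sum.cong) auto
  also have "(\<Sum>(i, j)\<in>A2. \<bar>real i - real j\<bar>) = (\<Sum>(i, j)\<in>A1. real j - real i)"
    by (rule sum.reindex_bij_witness[of _ prod.swap prod.swap])
      (use assms(2) in \<open>auto simp: A1_def A2_def dest: symD\<close>)
  finally show ?thesis unfolding A1_def by simp
qed

section \<open>Zigzag polygons\<close>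

definition ramp :: "nat \<Rightarrow> real \<Rightarrow> real" where
  "ramp j x = max 0 (min 1 (x - real j))"

text \<open>The piecewise linear interpolant of \<open>f\<close> at the nodes \<open>0..N\<close>,
  constant outside. As a sum of ramps it is visibly continuous, and each ramp moves only on its own
  unit interval.\<close>

definition interp :: "nat \<Rightarrow> (nat \<Rightarrow> real) \<Rightarrow> real \<Rightarrow> real" where
  "interp N f x = f 0 + (\<Sum>j<N. (f (Suc j) - f j) * ramp j x)"

lemma interp_segment:
  assumes "j < N" "real j \<le> x" "x \<le> real (Suc j)"
  shows "interp N f x = f j + (x - real j) * (f (Suc j) - f j)"
proof -
  have *: "{..<N} = {..<j} \<union> {j} \<union> {Suc j..<N}"
    using assms(1) by auto
  have "(\<Sum>i<N. (f (Suc i) - f i) * ramp i x) =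
      (\<Sum>i<j. (f (Suc i) - f i) * ramp i x) + (f (Suc j) - f j) * ramp j x
      + (\<Sum>i\<in>{Suc j..<N}. (f (Suc i) - f i) * ramp i x)"
    unfolding * by (subst sum.union_disjoint; force)+
  also have "(\<Sum>i<j. (f (Suc i) - f i) * ramp i x) = (\<Sum>i<j. f (Suc i) - f i)"
    using assms by (intro sum.cong) (auto simp: ramp_def)
  also have "\<dots> = f j - f 0"
    by (rule sum_lessThan_telescope)
  also have "(\<Sum>i\<in>{Suc j..<N}. (f (Suc i) - f i) * ramp i x) = 0"
    using assms by (intro sum.neutral) (auto simp: ramp_def)
  also have "ramp j x = x - real j"
    using assms by (simp add: ramp_def)
  finally show ?thesis
    unfolding interp_def by (simp add: algebra_simps)
qed

lemma interp_node:
  assumes "j \<le> N" "0 < N"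
  shows "interp N f (real j) = f j"
proof (cases "j < N")
  case True
  then show ?thesis using interp_segment[of j N "real j" f] by simp
next
  case False
  then obtain i where "N = Suc i" "j = Suc i"
    using assms by (metis le_antisym linorder_not_less Suc_pred)
  then show ?thesis using interp_segment[of i N "real j" f] by simp
qed

lemma continuous_on_interp [continuous_intros]:
  assumes "continuous_on S h"
  shows "continuous_on S (\<lambda>x. interp N f (h x))"
  unfolding interp_def ramp_def by (intro continuous_intros assms)

lemma nat_segment:
  assumes "0 \<le> x" "x \<le> real N" "0 < N"
  obtains j where "j < N" "real j \<le> x" "x \<le> real (Suc j)"
proof (cases "x = real N")
  case True
  then show ?thesis using that[of "N - 1"] assms by auto
next
  case False
  then show ?thesis
    using that[of "nat \<lfloor>x\<rfloor>"] assms by (simp add: floor_less_iff nat_less_iff) linarith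
qed

lemma interp_real:
  assumes "0 \<le> x" "x \<le> real N" "0 < N"
  shows "interp N real x = x"
proof -
  obtain j where "j < N" "real j \<le> x" "x \<le> real (Suc j)"
    using nat_segment assms by blast
  then show ?thesis using interp_segment[of j N x real] by simp
qed

text \<open>The slope bound is local to the steps between \<open>p\<close> and \<open>q\<close>,
  because slopes at pits are huge. The other ramps do not move between \<open>x\<close> and
  \<open>y\<close>, and all ramp increments add up to \<open>y - x\<close>.\<close>

lemma interp_variation:
  assumes K: "\<And>j. p \<le> j \<Longrightarrow> j < q \<Longrightarrow> \<bar>f (Suc j) - f j\<bar> \<le> K" and "q \<le> N" "0 < N"
    and "x \<in> {real p..real q}" "y \<in> {real p..real q}"
  shows "\<bar>interp N f x - interp N f y\<bar> \<le> K * \<bar>x - y\<bar>"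
  using assms(4,5)
proof (induction x y rule: linorder_wlog)
  case (le x y)
  have ramp_le: "\<bar>f (Suc j) - f j\<bar> * (ramp j y - ramp j x) \<le> K * (ramp j y - ramp j x)" for j
  proof (cases "p \<le> j \<and> j < q")
    case True
    then show ?thesis
      using K le by (intro mult_right_mono) (auto simp: ramp_def)
  next
    case False
    then have "ramp j y = ramp j x"
      using le by (auto simp: ramp_def)
    then show ?thesis by simp
  qed
  \<comment> \<open>The identity interpolates itself with all coefficients 1, so the ramps add up to
    the abscissa.\<close>
  have id: "z = (\<Sum>j<N. ramp j z)" if "0 \<le> z" "z \<le> real N" for z
    using interp_real[OF that \<open>0 < N\<close>] by (simp add: interp_def)
  have "interp N f y - interp N f x = (\<Sum>j<N. (f (Suc j) - f j) * (ramp j y - ramp j x))"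
    unfolding interp_def by (simp add: sum_subtractf[symmetric] right_diff_distrib)
  then have "\<bar>interp N f x - interp N f y\<bar> = \<bar>\<Sum>j<N. (f (Suc j) - f j) * (ramp j y - ramp j x)\<bar>"
    by (simp add: abs_minus_commute)
  also have "\<dots> \<le> (\<Sum>j<N. \<bar>(f (Suc j) - f j) * (ramp j y - ramp j x)\<bar>)"
    by (rule sum_abs)
  also have "\<dots> = (\<Sum>j<N. \<bar>f (Suc j) - f j\<bar> * (ramp j y - ramp j x))"
    using le by (intro sum.cong) (auto simp: abs_mult ramp_def)
  also have "\<dots> \<le> (\<Sum>j<N. K * (ramp j y - ramp j x))"
    by (intro sum_mono ramp_le)
  also have "\<dots> = K * ((\<Sum>j<N. ramp j y) - (\<Sum>j<N. ramp j x))"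
    by (simp add: sum_subtractf[symmetric] sum_distrib_left)
  also have "\<dots> = K * (y - x)"
    using id[of x] id[of y] le \<open>q \<le> N\<close> by simp
  finally show ?case using le by simp
next
  case (sym x y)
  then show ?case by (simp add: abs_minus_commute)
qed

lemma in_unit_segment_iff:
  "z \<in> closed_segment (Complex x y) (Complex (x + 1) y') \<longleftrightarrow>
     x \<le> Re z \<and> Re z \<le> x + 1 \<and> Im z = y + (Re z - x) * (y' - y)"
proof
  assume "z \<in> closed_segment (Complex x y) (Complex (x + 1) y')"
  then obtain u where u: "0 \<le> u" "u \<le> 1" "z = (1 - u) *\<^sub>R Complex x y + u *\<^sub>R Complex (x + 1) y'"
    by (auto simp: in_segment)
  then have "Re z = x + u" "Im z = y + u * (y' - y)"
    by (simp_all only: plus_complex.sel scaleR_complex.sel complex.sel) (simp_all add: algebra_simps)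
  then show "x \<le> Re z \<and> Re z \<le> x + 1 \<and> Im z = y + (Re z - x) * (y' - y)"
    using u by auto
next
  assume *: "x \<le> Re z \<and> Re z \<le> x + 1 \<and> Im z = y + (Re z - x) * (y' - y)"
  show "z \<in> closed_segment (Complex x y) (Complex (x + 1) y')"
    unfolding in_segment
    by (rule exI[of _ "Re z - x"]) (use * in \<open>auto simp: complex_eq_iff algebra_simps\<close>)
qed

lemma collinear_complex_cross:
  assumes "collinear {a, b, c :: complex}"
  shows "(Re b - Re a) * (Im c - Im a) = (Re c - Re a) * (Im b - Im a)"
proof -
  obtain u where u: "\<And>x y. x \<in> {a, b, c} \<Longrightarrow> y \<in> {a, b, c} \<Longrightarrow> \<exists>r. x - y = r *\<^sub>R u"
    using assms unfolding collinear_def by blast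
  obtain r s where "b - a = r *\<^sub>R u" "c - a = s *\<^sub>R u"
    using u[of b a] u[of c a] by auto
  then have "Re b - Re a = r * Re u" "Im b - Im a = r * Im u"
    "Re c - Re a = s * Re u" "Im c - Im a = s * Im u"
    by (metis minus_complex.simps scaleR_complex.simps)+
  then show ?thesis by simp
qed

text \<open>
  The nodes alternate between the two sides of the real axis, which makes the polygon a corridor
  that every path has to follow by a zigzag. If \<^term>\<open>f N = g N\<close>, it ends in a single vertex, so
  both parities of the number of vertices occur.
\<close>
locale zigzag =
  fixes N :: nat and f g :: "nat \<Rightarrow> real"
  assumes N2: "2 \<le> N"
    and f_less_g: "\<And>j. j < N \<Longrightarrow> f j < g j" and f_le_g: "f N \<le> g N"
    and f_pos: "\<And>j. j \<le> N \<Longrightarrow> odd j \<Longrightarrow> 0 < f j"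
    and g_neg: "\<And>j. j \<le> N \<Longrightarrow> even j \<Longrightarrow> g j < 0"
begin

abbreviation F :: "real \<Rightarrow> real" where "F \<equiv> interp N f"
abbreviation G :: "real \<Rightarrow> real" where "G \<equiv> interp N g"

definition region :: "complex set" where
  "region = {z. 0 \<le> Re z \<and> Re z \<le> real N \<and> F (Re z) \<le> Im z \<and> Im z \<le> G (Re z)}"

definition nverts :: nat where
  "nverts = (if f N = g N then 2 * N + 1 else 2 * N + 2)"

text \<open>Counterclockwise: the lower chain from left to right, then the upper chain back, so
  upper node \<open>j\<close> has index \<open>nverts - 1 - j\<close>. With a tip, index
  \<open>N\<close> belongs to both chains.\<close>

definition vert :: "nat \<Rightarrow> complex" where
  "vert i = (if i \<le> N then Complex i (f i) else Complex (real (nverts - 1 - i)) (g (nverts - 1 - i)))"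

definition verts :: "complex list" where
  "verts = map vert [0..<nverts]"

lemma N_pos: "0 < N" using N2 by simp

lemma F_less_G:
  assumes "0 \<le> x" "x < real N"
  shows "F x < G x"
proof -
  obtain j where j: "j < N" "real j \<le> x" "x < real (Suc j)"
  proof
    show "nat \<lfloor>x\<rfloor> < N" "real (nat \<lfloor>x\<rfloor>) \<le> x" "x < real (Suc (nat \<lfloor>x\<rfloor>))"
      using assms by linarith+
  qed
  define t where "t = x - real j"
  have t: "0 \<le> t" "t < 1" using j unfolding t_def by auto
  have "0 < (1 - t) * (g j - f j)"
    using t f_less_g[OF j(1)] by simp
  moreover have "0 \<le> t * (g (Suc j) - f (Suc j))"
    using t f_less_g[of "Suc j"] f_le_g j(1) by (cases "Suc j = N") auto
  ultimately show ?thesis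
    using interp_segment[of j N x f] interp_segment[of j N x g] j unfolding t_def
    by (simp add: algebra_simps)
qed

lemma F_le_G: "0 \<le> x \<Longrightarrow> x \<le> real N \<Longrightarrow> F x \<le> G x"
  using F_less_G[of x] f_le_g interp_node[of N N f] interp_node[of N N g] N_pos
  by (cases "x = real N") auto

lemma f_le_g_all: "j \<le> N \<Longrightarrow> f j \<le> g j"
  using f_less_g[of j] f_le_g by (cases "j = N") auto

section \<open>The vertex list is a simple polygon\<close>

lemma nverts_bounds: "2 * N < nverts" "nverts \<le> 2 * N + 2"
  by (auto simp: nverts_def)

lemma vert_lower: "j \<le> N \<Longrightarrow> vert j = Complex j (f j)"
  by (simp add: vert_def)

lemma vert_upper: "j \<le> N \<Longrightarrow> vert (nverts - 1 - j) = Complex j (g j)"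
proof -
  assume "j \<le> N"
  show ?thesis
  proof (cases "nverts - 1 - j \<le> N")
    case True
    then have "j = N" "f N = g N" "nverts - 1 - j = N"
      using \<open>j \<le> N\<close> by (auto simp: nverts_def split: if_splits)
    then show ?thesis by (simp add: vert_def)
  next
    case False
    then have "nverts - 1 - (nverts - 1 - j) = j"
      using nverts_bounds by linarith
    then show ?thesis using False by (simp add: vert_def)
  qed
qed

lemma polygon_edge_verts:
  "i < nverts \<Longrightarrow> polygon_edge verts i = closed_segment (vert i) (vert (Suc i mod nverts))"
  unfolding polygon_edge_def verts_def by simp

lemma in_lower_segment_iff:
  assumes "j < N"
  shows "z \<in> closed_segment (Complex j (f j)) (Complex (Suc j) (f (Suc j))) \<longleftrightarrow>
     real j \<le> Re z \<and> Re z \<le> real (Suc j) \<and> Im z = F (Re z)"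
  using interp_segment[OF assms, of "Re z" f] in_unit_segment_iff[of z "real j" "f j" "f (Suc j)"]
  by (auto simp: add.commute)

lemma in_upper_segment_iff:
  assumes "j < N"
  shows "z \<in> closed_segment (Complex (Suc j) (g (Suc j))) (Complex j (g j)) \<longleftrightarrow>
     real j \<le> Re z \<and> Re z \<le> real (Suc j) \<and> Im z = G (Re z)"
  using interp_segment[OF assms, of "Re z" g] in_unit_segment_iff[of z "real j" "g j" "g (Suc j)"]
  by (auto simp: add.commute closed_segment_commute)

text \<open>Each edge becomes a condition on coordinates, so that questions about edges turn into
  questions about \<open>F\<close> and \<open>G\<close>. The right side exists only without a
  tip.\<close>

lemma edge_cases [consumes 1, case_names lower upper left right]:
  assumes "i < nverts"
  obtains "i < N" "vert i = Complex i (f i)" "vert (Suc i mod nverts) = Complex (Suc i) (f (Suc i))"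
      "\<And>z. z \<in> polygon_edge verts i \<longleftrightarrow> real i \<le> Re z \<and> Re z \<le> real (Suc i) \<and> Im z = F (Re z)"
  | j where "j < N" "i = nverts - 2 - j" "vert i = Complex (Suc j) (g (Suc j))"
      "vert (Suc i mod nverts) = Complex j (g j)"
      "\<And>z. z \<in> polygon_edge verts i \<longleftrightarrow> real j \<le> Re z \<and> Re z \<le> real (Suc j) \<and> Im z = G (Re z)"
  | "i = nverts - 1" "vert i = Complex 0 (g 0)" "vert (Suc i mod nverts) = Complex 0 (f 0)"
      "\<And>z. z \<in> polygon_edge verts i \<longleftrightarrow> Re z = 0 \<and> f 0 \<le> Im z \<and> Im z \<le> g 0"
  | "i = N" "nverts = 2 * N + 2" "vert i = Complex N (f N)" "vert (Suc i mod nverts) = Complex N (g N)"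
      "\<And>z. z \<in> polygon_edge verts i \<longleftrightarrow> Re z = real N \<and> f N \<le> Im z \<and> Im z \<le> g N"
proof -
  consider "i < N" | "i = nverts - 1" | "i = N" "nverts = 2 * N + 2"
    | "i < nverts - 1" "nverts - 1 - N \<le> i"
    using assms nverts_bounds by linarith
  then show thesis
  proof cases
    case 1
    then have *: "vert i = Complex i (f i)" "vert (Suc i mod nverts) = Complex (Suc i) (f (Suc i))"
      using nverts_bounds vert_lower by auto
    show thesis
      using 1 *
      by (rule that(1)) (use 1 * polygon_edge_verts[OF assms] in_lower_segment_iff in auto)
  next
    case 2
    then have *: "vert i = Complex 0 (g 0)" "vert (Suc i mod nverts) = Complex 0 (f 0)"
      using nverts_bounds vert_lower[of 0] vert_upper[of 0] by auto
    show thesis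
      using 2 *
    proof (rule that(3))
      show "z \<in> polygon_edge verts i \<longleftrightarrow> Re z = 0 \<and> f 0 \<le> Im z \<and> Im z \<le> g 0" for z
        using * polygon_edge_verts[OF assms] f_less_g[OF N_pos]
        by (auto simp: closed_segment_same_Re closed_segment_eq_real_ivl)
    qed
  next
    case 3
    then have *: "vert i = Complex N (f N)" "vert (Suc i mod nverts) = Complex N (g N)"
      using vert_lower[of N] vert_upper[of N] by auto
    show thesis
      using 3 *
    proof (rule that(4))
      show "z \<in> polygon_edge verts i \<longleftrightarrow> Re z = real N \<and> f N \<le> Im z \<and> Im z \<le> g N" for z
        using * polygon_edge_verts[OF assms] f_le_g
        by (auto simp: closed_segment_same_Re closed_segment_eq_real_ivl)
    qed
  next
    case 4
    define j where "j = nverts - 2 - i"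
    have j: "j < N" "i = nverts - 2 - j"
      using 4 nverts_bounds N2 unfolding j_def by linarith+
    have "nverts - 1 - Suc j = i" "Suc i mod nverts = nverts - 1 - j"
      using 4 nverts_bounds j by auto
    then have *: "vert i = Complex (Suc j) (g (Suc j))" "vert (Suc i mod nverts) = Complex j (g j)"
      using vert_upper[of j] vert_upper[of "Suc j"] j(1) by auto
    show thesis
      using j *
      by (rule that(2)) (use j * polygon_edge_verts[OF assms] in_upper_segment_iff in auto)
  qed
qed

lemma vert_cases:
  assumes "i < nverts"
  obtains j where "j \<le> N" "i = j" "vert i = Complex j (f j)"
  | j where "j \<le> N" "i = nverts - 1 - j" "vert i = Complex j (g j)"
proof (cases "i \<le> N")
  case True
  then show ?thesis using that(1) vert_lower by blast
next
  case False
  then have "nverts - 1 - i \<le> N" "i = nverts - 1 - (nverts - 1 - i)"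
    using assms nverts_bounds by linarith+
  then show ?thesis using that(2) vert_upper by metis
qed

lemma inj_on_vert: "inj_on vert {..<nverts}"
proof (rule inj_onI, simp)
  fix i k assume ik: "i < nverts" "k < nverts" "vert i = vert k"
  have tip: "j = N \<and> nverts = 2 * N + 1" if "j \<le> N" "f j = g j" for j
    using that f_less_g[of j] by (cases "j = N") (auto simp: nverts_def)
  show "i = k"
    using ik(1)
  proof (cases rule: vert_cases)
    case (1 j)
    show ?thesis
      using ik(2) by (cases rule: vert_cases) (use 1 ik(3) tip in force)+
  next
    case (2 j)
    show ?thesis
      using ik(2) by (cases rule: vert_cases) (use 2 ik(3) tip in force)+
  qed
qed

text \<open>A vertex has an integer abscissa, so on a chain edge it shares its abscissa with one of
  the two ends, and the chain fixes its height.\<close>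

lemma vert_on_edge:
  assumes "i < nverts" "k < nverts" "vert k \<in> polygon_edge verts i"
  shows "vert k \<in> {vert i, vert (Suc i mod nverts)}"
proof -
  have node: "F (real j) = f j" "G (real j) = g j" if "j \<le> N" for j
    using that interp_node N_pos by auto
  have tip: "j = N" if "j \<le> N" "f j = g j" for j
    using that f_less_g[of j] by (cases "j = N") auto
  obtain j where j: "j \<le> N" "vert k = Complex j (f j) \<or> vert k = Complex j (g j)"
    using assms(2) by (cases rule: vert_cases) auto
  show ?thesis
    using assms(1)
  proof (cases rule: edge_cases)
    case lower
    then have "j = i \<or> j = Suc i" "Im (vert k) = f j"
      using assms(3) j node by auto
    then show ?thesis using lower j by (auto simp: complex_eq_iff)
  next
    case (upper l)
    then have "j = l \<or> j = Suc l" "Im (vert k) = g j"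
      using assms(3) j node by auto
    then show ?thesis using upper j by (auto simp: complex_eq_iff)
  next
    case left
    then show ?thesis using assms(3) j by auto
  next
    case right
    then show ?thesis using assms(3) j by auto
  qed
qed

lemma node_is_vert:
  assumes "Re z = real j" "j \<le> N" "Im z = F (Re z) \<or> Im z = G (Re z)"
  shows "\<exists>k<nverts. z = vert k"
proof -
  have "z = Complex j (f j) \<or> z = Complex j (g j)"
    using assms interp_node[of j N] N_pos by (auto simp: complex_eq_iff)
  moreover have "j < nverts" "nverts - 1 - j < nverts"
    using assms(2) nverts_bounds by linarith+
  ultimately show ?thesis
    using vert_lower[of j] vert_upper[of j] assms(2) by metis
qed

text \<open>Edges of one chain share an abscissa only at a node, edges of different chains meet only
  at \<open>N\<close> because \<open>F < G\<close> before, and the vertical sides have abscissa 0 or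
  \<open>N\<close>. So a common point lies on a chain over an integer.\<close>

lemma edge_Int_edge:
  assumes "i < nverts" "k < nverts" "i \<noteq> k" and zi: "z \<in> polygon_edge verts i"
    and zk: "z \<in> polygon_edge verts k"
  shows "\<exists>l<nverts. z = vert l"
proof -
  have mid: "Re z = real i \<or> Re z = real k"
    if "real i \<le> Re z" "Re z \<le> real (Suc i)" "real k \<le> Re z" "Re z \<le> real (Suc k)" "i \<noteq> k" for i k :: nat
    using that by linarith
  have FG: "Re z = real N" if "j < N" "real j \<le> Re z" "Re z \<le> real (Suc j)" "F (Re z) = G (Re z)" for j
  proof (rule ccontr)
    assume "Re z \<noteq> real N"
    then have "0 \<le> Re z" "Re z < real N" using that by linarith+
    then show False using that(4) F_less_G[of "Re z"] by simp
  qed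
  have node: ?thesis if "Re z = real j" "j \<le> N" "Im z = F (Re z) \<or> Im z = G (Re z)" for j
    using node_is_vert that by blast
  have end0: ?thesis if "Re z = 0" "Im z = F (Re z) \<or> Im z = G (Re z)"
    using node[of 0] that by simp
  have endN: ?thesis if "Re z = real N" "Im z = F (Re z) \<or> Im z = G (Re z)"
    using node[of N] that by simp
  show ?thesis
    using assms(1)
  proof (cases rule: edge_cases)
    case lower
    then have i: "i < N" "real i \<le> Re z" "Re z \<le> real (Suc i)" "Im z = F (Re z)"
      using zi by blast+
    show ?thesis using assms(2)
    proof (cases rule: edge_cases)
      case lower
      then have k: "k < N" "real k \<le> Re z" "Re z \<le> real (Suc k)"
        using zk by blast+
      then have "Re z = real i \<or> Re z = real k"
        using i mid \<open>i \<noteq> k\<close> by blast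
      then show ?thesis
        using i k node[of i] node[of k] less_imp_le by blast
    next
      case (upper j)
      then have "F (Re z) = G (Re z)" using i zk by force
      then show ?thesis using endN FG i by blast
    next
      case left
      then show ?thesis using i zk end0 by blast
    next
      case right
      then show ?thesis using i zk endN by blast
    qed
  next
    case (upper l)
    then have i: "l < N" "real l \<le> Re z" "Re z \<le> real (Suc l)" "Im z = G (Re z)"
      using zi by blast+
    show ?thesis using assms(2)
    proof (cases rule: edge_cases)
      case lower
      then have "F (Re z) = G (Re z)" using i zk by force
      then show ?thesis using endN FG i by blast
    next
      case (upper j)
      then have j: "j < N" "real j \<le> Re z" "Re z \<le> real (Suc j)"
        using zk by blast+
      have "l \<noteq> j"
        using \<open>i = nverts - 2 - l\<close> upper(2) \<open>i \<noteq> k\<close> by blast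
      then have "Re z = real l \<or> Re z = real j"
        using i j mid by blast
      then show ?thesis
        using i j node[of l] node[of j] less_imp_le by blast
    next
      case left
      then show ?thesis using i zk end0 by blast
    next
      case right
      then show ?thesis using i zk endN by blast
    qed
  next
    case left
    then have i: "i = nverts - 1" "Re z = 0"
      using zi by blast+
    show ?thesis using assms(2)
    proof (cases rule: edge_cases)
      case lower
      then show ?thesis using i zk end0 by blast
    next
      case (upper j)
      then show ?thesis using i zk end0 by blast
    next
      case left
      then show ?thesis using i \<open>i \<noteq> k\<close> by blast
    next
      case right
      then have "Re z = real N" using zk by blast
      then show ?thesis using i N_pos by simp
    qed
  next
    case right
    then have i: "i = N" "Re z = real N"
      using zi by blast+
    show ?thesis using assms(2)
    proof (cases rule: edge_cases)
      case lower
      then show ?thesis using i zk endN by blast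
    next
      case (upper j)
      then show ?thesis using i zk endN by blast
    next
      case left
      then have "Re z = 0" using zk by blast
      then show ?thesis using i N_pos by simp
    next
      case right
      then show ?thesis using i \<open>i \<noteq> k\<close> by blast
    qed
  qed
qed

text \<open>Three collinear nodes would make the middle height the mean of its neighbours, but
  consecutive heights have opposite signs.\<close>

lemma f_turn: "Suc (Suc j) \<le> N \<Longrightarrow> f (Suc (Suc j)) - f j \<noteq> 2 * (f (Suc j) - f j)"
  using f_pos[of j] f_pos[of "Suc j"] f_pos[of "Suc (Suc j)"] g_neg[of j] g_neg[of "Suc j"]
    g_neg[of "Suc (Suc j)"] f_le_g_all[of j] f_le_g_all[of "Suc j"] f_le_g_all[of "Suc (Suc j)"]
  by (cases "even j") auto

lemma g_turn: "Suc (Suc j) \<le> N \<Longrightarrow> g (Suc (Suc j)) - g j \<noteq> 2 * (g (Suc j) - g j)"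
  using f_pos[of j] f_pos[of "Suc j"] f_pos[of "Suc (Suc j)"] g_neg[of j] g_neg[of "Suc j"]
    g_neg[of "Suc (Suc j)"] f_le_g_all[of j] f_le_g_all[of "Suc j"] f_le_g_all[of "Suc (Suc j)"]
  by (cases "even j") auto

lemma vert_not_collinear:
  assumes "i < nverts"
  shows "\<not> collinear {vert i, vert (Suc i mod nverts), vert (Suc (Suc i) mod nverts)}"
proof
  assume "collinear {vert i, vert (Suc i mod nverts), vert (Suc (Suc i) mod nverts)}"
  note cross = collinear_complex_cross[OF this]
  have f0: "f 0 \<noteq> g 0" using f_less_g[OF N_pos] by simp
  show False
    using assms
  proof (cases rule: edge_cases)
    case lower
    show False
    proof (cases "Suc (Suc i) \<le> N")
      case True
      then have "vert (Suc (Suc i) mod nverts) = Complex (Suc (Suc i)) (f (Suc (Suc i)))"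
        using vert_lower nverts_bounds N2 by auto
      then show False using cross lower f_turn[OF True] by (auto simp: algebra_simps)
    next
      case False
      then have i: "N = Suc i" using lower by linarith
      \<comment> \<open>The vertex after node \<open>N\<close> is the upper node \<open>N\<close>
        or, with a tip, already the upper node \<open>N - 1\<close>.\<close>
      show False
      proof (cases "f N = g N")
        case True
        then have "nverts = 2 * N + 1" by (simp add: nverts_def)
        then have "Suc (Suc i) < nverts" "Suc (Suc i) = nverts - 1 - i"
          using i N2 by linarith+
        then have "Suc (Suc i) mod nverts = nverts - 1 - i"
          by (metis mod_less)
        then have "vert (Suc (Suc i) mod nverts) = Complex i (g i)"
          using vert_upper[of i] i by simp
        then show False using cross lower f_less_g[of i] i by auto
      next
        case False
        then have "nverts = 2 * N + 2" by (simp add: nverts_def)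
        then have "Suc (Suc i) < nverts" "Suc (Suc i) = nverts - 1 - N"
          using i N2 by linarith+
        then have "Suc (Suc i) mod nverts = nverts - 1 - N"
          by (metis mod_less)
        then have "vert (Suc (Suc i) mod nverts) = Complex N (g N)"
          using vert_upper[of N] by simp
        then show False using cross lower False i by auto
      qed
    qed
  next
    case (upper j)
    show False
    proof (cases j)
      case 0
      then have "Suc (Suc i) = nverts"
        using upper(2) nverts_bounds N2 by linarith
      then have "Suc (Suc i) mod nverts = 0"
        by simp
      then have "vert (Suc (Suc i) mod nverts) = Complex 0 (f 0)"
        using vert_lower[of 0] by simp
      then show False using cross upper 0 f0 by auto
    next
      case (Suc l)
      then have "Suc (Suc i) mod nverts = nverts - 1 - l"
        using upper nverts_bounds N2 by auto
      then have "vert (Suc (Suc i) mod nverts) = Complex l (g l)"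
        using vert_upper[of l] upper Suc by simp
      then show False using cross upper Suc g_turn[of l] by (auto simp: algebra_simps)
    qed
  next
    case left
    then have "Suc (Suc i) mod nverts = Suc 0"
      using nverts_bounds N2 by (auto simp: mod_Suc)
    then have "vert (Suc (Suc i) mod nverts) = Complex 1 (f 1)"
      using vert_lower[of "Suc 0"] N2 by simp
    then show False using cross left f0 by auto
  next
    case right
    then have "Suc (Suc i) mod nverts = nverts - 1 - (N - 1)" and "f N \<noteq> g N"
      using N2 by (auto simp: nverts_def split: if_splits)
    then have "vert (Suc (Suc i) mod nverts) = Complex (real (N - 1)) (g (N - 1))"
      using vert_upper[of "N - 1"] by simp
    then show False using cross right \<open>f N \<noteq> g N\<close> N2 by (auto simp: of_nat_diff)
  qed
qed

lemma simple_polygon_verts: "simple_polygon verts"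
proof -
  have len: "length verts = nverts" by (simp add: verts_def)
  have nth: "verts ! i = vert i" if "i < nverts" for i
    using that by (simp add: verts_def)
  have nths: "verts ! (i mod nverts) = vert (i mod nverts)" for i
    using nth nverts_bounds by simp
  show ?thesis
    unfolding simple_polygon_def len nths
  proof (intro conjI allI impI)
    show "3 \<le> nverts" using nverts_bounds N2 by linarith
    show "distinct verts"
      using inj_on_vert by (simp add: verts_def distinct_map lessThan_atLeast0)
  next
    fix i k assume ik: "i < nverts" "k < nverts" "i \<noteq> k"
    show "polygon_edge verts i \<inter> polygon_edge verts k =
      {verts ! i, vert (Suc i mod nverts)} \<inter> {verts ! k, vert (Suc k mod nverts)}"
    proof
      show "polygon_edge verts i \<inter> polygon_edge verts k \<subseteq>
        {verts ! i, vert (Suc i mod nverts)} \<inter> {verts ! k, vert (Suc k mod nverts)}"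
      proof
        fix z assume z: "z \<in> polygon_edge verts i \<inter> polygon_edge verts k"
        then obtain l where "l < nverts" "z = vert l"
          using edge_Int_edge[OF ik] by blast
        then show "z \<in> {verts ! i, vert (Suc i mod nverts)} \<inter> {verts ! k, vert (Suc k mod nverts)}"
          using vert_on_edge[of i l] vert_on_edge[of k l] z ik nth by auto
      qed
    next
      have "{verts ! i, vert (Suc i mod nverts)} \<subseteq> polygon_edge verts i" if "i < nverts" for i
        using polygon_edge_verts[OF that] nth[OF that] by auto
      then show "{verts ! i, vert (Suc i mod nverts)} \<inter> {verts ! k, vert (Suc k mod nverts)} \<subseteq>
        polygon_edge verts i \<inter> polygon_edge verts k"
        using ik by blast
    qed
  next
    fix i assume "i < nverts"
    then show "\<not> collinear {verts ! i, vert (Suc i mod nverts), vert (Suc (Suc i) mod nverts)}"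
      using vert_not_collinear nth by simp
  qed
qed

section \<open>The region enclosed by the polygon\<close>

lemma in_polygon_boundary_iff:
  "z \<in> polygon_boundary verts \<longleftrightarrow> z \<in> region \<and>
     (Im z = F (Re z) \<or> Im z = G (Re z) \<or> Re z = 0 \<or> Re z = real N)"
proof -
  have len: "length verts = nverts" by (simp add: verts_def)
  have node: "F 0 = f 0" "G 0 = g 0" "F (real N) = f N" "G (real N) = g N"
    using interp_node[of 0 N] interp_node[of N N] N_pos by auto
  show ?thesis
  proof
    assume "z \<in> polygon_boundary verts"
    then obtain i where i: "i < nverts" "z \<in> polygon_edge verts i"
      unfolding polygon_boundary_def len by blast
    from i(1) show "z \<in> region \<and>
     (Im z = F (Re z) \<or> Im z = G (Re z) \<or> Re z = 0 \<or> Re z = real N)"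
    proof (cases rule: edge_cases)
      case lower
      then show ?thesis using i(2) F_le_G[of "Re z"] unfolding region_def by auto
    next
      case (upper j)
      then show ?thesis using i(2) F_le_G[of "Re z"] unfolding region_def by auto
    next
      case left
      then show ?thesis using i(2) node unfolding region_def by auto
    next
      case right
      then show ?thesis using i(2) node unfolding region_def by auto
    qed
  next
    assume *: "z \<in> region \<and> (Im z = F (Re z) \<or> Im z = G (Re z) \<or> Re z = 0 \<or> Re z = real N)"
    then have z: "0 \<le> Re z" "Re z \<le> real N" "F (Re z) \<le> Im z" "Im z \<le> G (Re z)"
      unfolding region_def by auto
    obtain j where j: "j < N" "real j \<le> Re z" "Re z \<le> real (Suc j)"
      using nat_segment[OF z(1,2) N_pos] by blast
    have lower: ?thesis if "Im z = F (Re z)"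
    proof -
      have "j < nverts" using j(1) nverts_bounds by linarith
      moreover from this have "z \<in> polygon_edge verts j"
        using j that vert_lower nverts_bounds in_lower_segment_iff[OF j(1)] polygon_edge_verts by simp
      ultimately show ?thesis using * unfolding polygon_boundary_def len by blast
    qed
    have upper: ?thesis if "Im z = G (Re z)"
    proof -
      define i where "i = nverts - 1 - Suc j"
      have i: "i < nverts" "Suc i mod nverts = nverts - 1 - j"
        using j(1) nverts_bounds unfolding i_def by auto
      have "vert i = Complex (Suc j) (g (Suc j))" "vert (nverts - 1 - j) = Complex j (g j)"
        unfolding i_def using j(1) vert_upper[of j] vert_upper[of "Suc j"] by simp_all
      then have "z \<in> polygon_edge verts i"
        using j that i in_upper_segment_iff[OF j(1)] polygon_edge_verts by simp
      then show ?thesis using i * unfolding polygon_boundary_def len by blast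
    qed
    have left: ?thesis if "Re z = 0"
    proof -
      have "nverts - 1 < nverts" using nverts_bounds by linarith
      then have "z \<in> polygon_edge verts (nverts - 1)"
        using that z node f_less_g[OF N_pos] vert_upper[of 0] vert_lower[of 0] nverts_bounds
        by (auto simp: polygon_edge_verts closed_segment_same_Re closed_segment_eq_real_ivl)
      then show ?thesis using \<open>nverts - 1 < nverts\<close> * unfolding polygon_boundary_def len by blast
    qed
    have right: ?thesis if "Re z = real N" "f N \<noteq> g N"
    proof -
      have nv: "nverts = 2 * N + 2" using that(2) by (simp add: nverts_def)
      then have "z \<in> polygon_edge verts N"
        using that z node f_le_g vert_upper[of N] vert_lower[of N]
        by (auto simp: polygon_edge_verts closed_segment_same_Re closed_segment_eq_real_ivl)
      then show ?thesis using nv * unfolding polygon_boundary_def len by fastforce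
    qed
    show "z \<in> polygon_boundary verts"
    \<comment> \<open>With a tip the right side has shrunk to the end of the lower chain.\<close>
    proof (cases "Re z = real N \<and> f N = g N")
      case True
      then have "Im z = F (Re z)" using z node by simp
      then show ?thesis using lower * by blast
    next
      case False
      then show ?thesis using * lower upper left right by blast
    qed
  qed
qed

lemma closed_region: "closed region"
  unfolding region_def
  by (intro closed_Collect_conj closed_Collect_le continuous_intros)

lemma bounded_region: "bounded region"
proof -
  have "bounded (F ` {0..real N})" "bounded (G ` {0..real N})"
    by (auto intro!: compact_imp_bounded compact_continuous_image continuous_on_interp continuous_on_id)
  then obtain a b where ab: "\<And>x. x \<in> {0..real N} \<Longrightarrow> \<bar>F x\<bar> \<le> a" "\<And>x. x \<in> {0..real N} \<Longrightarrow> \<bar>G x\<bar> \<le> b"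
    unfolding bounded_iff by force
  have "norm z \<le> real N + (a + b)" if "z \<in> region" for z
  proof -
    have "\<bar>Re z\<bar> \<le> real N" "\<bar>Im z\<bar> \<le> a + b"
      using that ab[of "Re z"] unfolding region_def by auto
    then show ?thesis using cmod_le[of z] by linarith
  qed
  then show ?thesis unfolding bounded_iff by blast
qed

text \<open>The open strip \<open>U\<close> has its frontier in the boundary, so a component of the
  complement that meets \<open>U\<close> stays in the bounded region. From a point outside the
  region a vertical ray, upwards or downwards, avoids it, so that component is unbounded.\<close>

lemma polygon_region_verts: "polygon_region verts = region"
proof -
  define B where "B = polygon_boundary verts"
  define U where "U = {z. 0 < Re z \<and> Re z < real N \<and> F (Re z) < Im z \<and> Im z < G (Re z)}"
  have BR: "B \<subseteq> region" "region - U \<subseteq> B" "U \<inter> B = {}" "U \<subseteq> region"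
    unfolding B_def U_def by (auto simp: in_polygon_boundary_iff region_def)
  have "open U"
    unfolding U_def by (intro open_Collect_conj open_Collect_less continuous_intros)
  then have front: "frontier U \<subseteq> B"
    using closure_minimal[OF BR(4) closed_region] BR(2) by (auto simp: frontier_def interior_open)
  have "U \<subseteq> inside B"
  proof
    fix z assume z: "z \<in> U"
    have "connected_component_set (- B) z \<subseteq> U"
    proof (rule ccontr)
      assume out: "\<not> ?thesis"
      have "z \<in> connected_component_set (- B) z"
        using z BR(3) by (auto simp: connected_component_refl_eq)
      then have "connected_component_set (- B) z \<inter> U \<noteq> {}" "connected_component_set (- B) z - U \<noteq> {}"
        using z out by blast+
      then have "connected_component_set (- B) z \<inter> frontier U \<noteq> {}"
        by (intro connected_Int_frontier connected_connected_component)
      then show False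
        using front connected_component_subset[of "- B" z] by blast
    qed
    then have "bounded (connected_component_set (- B) z)"
      using bounded_region BR(4) bounded_subset by blast
    then show "z \<in> inside B"
      using z BR(3) unfolding inside_def by auto
  qed
  moreover have "inside B \<subseteq> region"
  proof
    fix z assume z: "z \<in> inside B"
    show "z \<in> region"
    proof (rule ccontr)
      assume "z \<notin> region"
      define \<sigma> :: real where "\<sigma> = (if Im z < F (Re z) then -1 else 1)"
      have \<sigma>: "\<sigma> = 1 \<or> \<sigma> = -1" "z + Complex 0 (\<sigma> * r) \<notin> region" if "0 \<le> r" for r
        using \<open>z \<notin> region\<close> that unfolding \<sigma>_def region_def by auto
      define ray where "ray = (\<lambda>r. z + Complex 0 (\<sigma> * r)) ` {0..}"
      have "continuous_on {0..} (\<lambda>r. z + Complex 0 (\<sigma> * r))"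
        by (rule continuous_on_add[OF continuous_on_const continuous_on_Complex[OF
          continuous_on_const continuous_on_mult[OF continuous_on_const continuous_on_id]]])
      then have "connected ray"
        unfolding ray_def
        by (rule connected_continuous_image) (rule convex_connected, rule convex_real_interval)
      moreover have "ray \<subseteq> - B"
      proof
        fix w assume "w \<in> ray"
        then obtain r where "0 \<le> r" "w = z + Complex 0 (\<sigma> * r)"
          unfolding ray_def by blast
        then show "w \<in> - B"
          using \<sigma>(2)[of r] BR(1) by blast
      qed
      moreover have "z \<in> ray"
        unfolding ray_def by (rule image_eqI[of _ _ 0]) (simp_all add: complex_eq_iff)
      ultimately have "ray \<subseteq> connected_component_set (- B) z"
        by (intro connected_component_maximal)
      then have "bounded ray"
        using z bounded_subset unfolding inside_def by blast
      then obtain a where a: "\<And>w. w \<in> ray \<Longrightarrow> norm w \<le> a"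
        unfolding bounded_iff by blast
      define r where "r = \<bar>a\<bar> + norm z + 1"
      have "z + Complex 0 (\<sigma> * r) \<in> ray"
        unfolding ray_def by (rule imageI) (simp add: r_def add_nonneg_nonneg)
      then have "norm (z + Complex 0 (\<sigma> * r)) \<le> a"
        using a by blast
      moreover have "norm (Complex 0 (\<sigma> * r)) = r"
      proof -
        have "\<bar>\<sigma>\<bar> = 1" "0 \<le> r" unfolding \<sigma>_def r_def by auto
        then show ?thesis by (simp add: cmod_def abs_mult)
      qed
      moreover have "norm (Complex 0 (\<sigma> * r)) \<le> norm (z + Complex 0 (\<sigma> * r)) + norm z"
        using norm_triangle_ineq4[of "z + Complex 0 (\<sigma> * r)" z] by simp
      ultimately show False unfolding r_def by linarith
    qed
  qed
  ultimately show ?thesis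
    unfolding polygon_region_def B_def[symmetric] using BR by blast
qed

end

section \<open>Distances and complexity of links\<close>

lemma curve_length_ge_via:
  assumes "t \<in> {0..1}"
  shows "ennreal (dist (\<gamma> 0) (\<gamma> t) + dist (\<gamma> t) (\<gamma> 1)) \<le> curve_length \<gamma>"
proof -
  have "ennreal (dist (\<gamma> 0) (\<gamma> t) + dist (\<gamma> t) (\<gamma> 1)) =
      (\<Sum>i<length [0, t, 1] - 1. ennreal (dist (\<gamma> ([0, t, 1] ! i)) (\<gamma> ([0, t, 1] ! Suc i))))"
    by (simp add: numeral_2_eq_2 ennreal_plus)
  also have "\<dots> \<le> curve_length \<gamma>"
    unfolding curve_length_def using assms by (intro SUP_upper) auto
  finally show ?thesis .
qed

text \<open>\<open>\<phi>\<close> acts as a length counter: its increments dominate distances, so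
  the sum over any subdivision telescopes to at most its total increment.\<close>

lemma curve_length_le:
  assumes "\<And>s t. 0 \<le> s \<Longrightarrow> s \<le> t \<Longrightarrow> t \<le> 1 \<Longrightarrow> dist (\<gamma> s) (\<gamma> t) \<le> \<phi> t - \<phi> s"
  shows "curve_length \<gamma> \<le> ennreal (\<phi> 1 - \<phi> 0)"
  unfolding curve_length_def
proof (rule SUP_least)
  fix ts :: "real list"
  assume "ts \<in> {ts. sorted ts \<and> set ts \<subseteq> {0..1}}"
  then have sorted: "sorted ts" and sub: "set ts \<subseteq> {0..1}"
    by blast+
  have ts: "0 \<le> ts ! i \<and> ts ! i \<le> 1" if "i < length ts" for i
    using subsetD[OF sub nth_mem[OF that]] by simp
  have mono: "\<phi> s \<le> \<phi> t" if "0 \<le> s" "s \<le> t" "t \<le> 1" for s t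
    using assms[OF that] zero_le_dist[of "\<gamma> s" "\<gamma> t"] by linarith
  have "(\<Sum>i<length ts - 1. dist (\<gamma> (ts ! i)) (\<gamma> (ts ! Suc i))) \<le>
      (\<Sum>i<length ts - 1. \<phi> (ts ! Suc i) - \<phi> (ts ! i))"
  proof (rule sum_mono)
    fix i assume "i \<in> {..<length ts - 1}"
    then have "i < length ts" "Suc i < length ts" by auto
    then show "dist (\<gamma> (ts ! i)) (\<gamma> (ts ! Suc i)) \<le> \<phi> (ts ! Suc i) - \<phi> (ts ! i)"
      using ts[of i] ts[of "Suc i"] sorted_nth_mono[OF sorted, of i "Suc i"] by (intro assms) auto
  qed
  also have "\<dots> = \<phi> (ts ! (length ts - 1)) - \<phi> (ts ! 0)"
    by (rule sum_lessThan_telescope)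
  also have "\<dots> \<le> \<phi> 1 - \<phi> 0"
  proof (cases "ts = []")
    case False
    then show ?thesis
      using ts[of 0] ts[of "length ts - 1"] by (intro diff_mono mono) auto
  next
    case True
    then show ?thesis using mono[of 0 1] by simp
  qed
  finally show "(\<Sum>i<length ts - 1. ennreal (dist (\<gamma> (ts ! i)) (\<gamma> (ts ! Suc i)))) \<le> ennreal (\<phi> 1 - \<phi> 0)"
    by (simp add: sum_ennreal ennreal_leI)
qed

text \<open>The real part is continuous, so every path meets the vertical line at \<open>c\<close>,
  and the two chords through that point bound its length. All lower bounds on distances come from
  this, with \<open>c\<close> an even node.\<close>

lemma geodesic_dist_ge_via:
  assumes c: "min (Re p) (Re q) \<le> c" "c \<le> max (Re p) (Re q)"
    and b: "\<And>z. z \<in> P \<Longrightarrow> Re z = c \<Longrightarrow> b \<le> dist p z + dist z q"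
  shows "ennreal b \<le> geodesic_dist P p q"
  unfolding geodesic_dist_def
proof (rule INF_greatest)
  fix \<gamma> assume "\<gamma> \<in> paths_in P p q"
  then have \<gamma>: "continuous_on {0..1} \<gamma>" "\<gamma> ` {0..1} \<subseteq> P" "\<gamma> 0 = p" "\<gamma> 1 = q"
    unfolding paths_in_def path_def path_image_def pathstart_def pathfinish_def by blast+
  have cont: "continuous_on {0..1} (\<lambda>t. Re (\<gamma> t))"
    using \<gamma>(1) by (rule continuous_on_Re)
  obtain t where t: "t \<in> {0..1}" "Re (\<gamma> t) = c"
  proof (cases "Re p \<le> Re q")
    case True
    then have "\<exists>t\<ge>0. t \<le> 1 \<and> Re (\<gamma> t) = c"
      using c cont \<gamma>(3,4) by (intro IVT') simp_all
    then show ?thesis using that by auto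
  next
    case False
    then have "\<exists>t\<ge>0. t \<le> 1 \<and> Re (\<gamma> t) = c"
      using c cont \<gamma>(3,4) by (intro IVT2') simp_all
    then show ?thesis using that by auto
  qed
  then have "b \<le> dist p (\<gamma> t) + dist (\<gamma> t) q"
    using b \<gamma>(2) by blast
  then have "ennreal b \<le> ennreal (dist (\<gamma> 0) (\<gamma> t) + dist (\<gamma> t) (\<gamma> 1))"
    unfolding \<gamma>(3,4) by (rule ennreal_leI)
  also have "\<dots> \<le> curve_length \<gamma>"
    using t(1) by (rule curve_length_ge_via)
  finally show "ennreal b \<le> curve_length \<gamma>" .
qed

text \<open>Half-open, so that two sites have exactly as many nodes between them as their abscissas
  differ; symmetric in \<open>p\<close> and \<open>q\<close>, since links are unordered.\<close>

definition nodes_between :: "complex \<Rightarrow> complex \<Rightarrow> nat set" where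
  "nodes_between p q = {j. min (Re p) (Re q) < real j \<and> real j \<le> max (Re p) (Re q)}"

lemma finite_nodes_between: "finite (nodes_between p q)"
proof (rule finite_subset)
  show "nodes_between p q \<subseteq> {..nat \<lceil>max (Re p) (Re q)\<rceil>}"
    unfolding nodes_between_def by (auto simp: le_nat_iff) linarith+
qed simp

lemma nodes_between_triangle: "nodes_between p r \<subseteq> nodes_between p q \<union> nodes_between q r"
  unfolding nodes_between_def by auto

lemma card_nodes_between_triangle:
  "card (nodes_between p r) \<le> card (nodes_between p q) + card (nodes_between q r)"
  using card_mono[OF _ nodes_between_triangle] card_Un_le finite_nodes_between
  by (metis finite_Un order_trans)

lemma pathstart_polygonal_path: "xs \<noteq> [] \<Longrightarrow> pathstart (polygonal_path xs) = hd xs"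
  by (induction xs rule: polygonal_path.induct) auto

text \<open>A nonempty infimum in \<open>enat\<close> is attained and an empty one is infinite, so a
  bound for each polygonal representation, or each orientation of a link, passes to the
  infimum.\<close>

lemma enat_le_two_Inf:
  assumes "\<And>x. x \<in> X \<Longrightarrow> enat c \<le> 2 * x"
  shows "enat c \<le> 2 * Inf X"
proof (cases "X = {}")
  case True
  have "2 * \<infinity> = (\<infinity> :: enat)"
    by (simp add: imult_is_infinity)
  then show ?thesis using True by (simp add: Inf_enat_def)
next
  case False
  then have "Inf X \<in> X"
    unfolding Inf_enat_def by (auto intro: LeastI)
  then show ?thesis using assms by blast
qed

definition link_nodes :: "complex set \<Rightarrow> nat set" where
  "link_nodes e = (\<Union>u\<in>e. \<Union>v\<in>e. nodes_between u v)"

lemma link_nodes_pair: "link_nodes {u, v} = nodes_between u v"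
  unfolding link_nodes_def by (auto simp: nodes_between_def)

context zigzag
begin

lemma region_odd_node: "z \<in> region \<Longrightarrow> Re z = real j \<Longrightarrow> odd j \<Longrightarrow> 0 < Im z"
  and region_even_node: "z \<in> region \<Longrightarrow> Re z = real j \<Longrightarrow> even j \<Longrightarrow> Im z < 0"
  and region_node: "z \<in> region \<Longrightarrow> Re z = real j \<Longrightarrow> j \<le> N \<and> f j \<le> Im z \<and> Im z \<le> g j"
proof -
  have *: "j \<le> N \<and> f j \<le> Im z \<and> Im z \<le> g j" if "z \<in> region" "Re z = real j" for z j
    using that interp_node[of j N f] interp_node[of j N g] N_pos unfolding region_def by auto
  show "z \<in> region \<Longrightarrow> Re z = real j \<Longrightarrow> odd j \<Longrightarrow> 0 < Im z"
    using *[of z j] f_pos[of j] by auto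
  show "z \<in> region \<Longrightarrow> Re z = real j \<Longrightarrow> even j \<Longrightarrow> Im z < 0"
    using *[of z j] g_neg[of j] by auto
  show "z \<in> region \<Longrightarrow> Re z = real j \<Longrightarrow> j \<le> N \<and> f j \<le> Im z \<and> Im z \<le> g j"
    using * .
qed

text \<open>Along a segment the height is affine in the abscissa, so over three consecutive nodes
  the middle value is the mean of the outer ones, whereas the region forces alternating
  signs.\<close>

lemma card_nodes_between_segment:
  assumes "closed_segment p q \<subseteq> region"
  shows "card (nodes_between p q) \<le> 2"
proof (cases "nodes_between p q = {}")
  case False
  define j where "j = Min (nodes_between p q)"
  have j: "j \<in> nodes_between p q" "\<And>i. i \<in> nodes_between p q \<Longrightarrow> j \<le> i"
    unfolding j_def using False finite_nodes_between by auto
  have "Suc (Suc j) \<notin> nodes_between p q"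
  proof
    assume jj: "Suc (Suc j) \<in> nodes_between p q"
    have ne: "Re q - Re p \<noteq> 0"
      using j(1) unfolding nodes_between_def by auto
    define \<kappa> where "\<kappa> = (Im q - Im p) / (Re q - Re p)"
    define h where "h x = Im p + (x - Re p) * \<kappa>" for x
    have on: "Complex x (h x) \<in> region" if "min (Re p) (Re q) \<le> x" "x \<le> max (Re p) (Re q)" for x
    proof -
      define u where "u = (x - Re p) / (Re q - Re p)"
      have u: "0 \<le> u" "u \<le> 1"
        using that ne unfolding u_def by (auto simp: divide_simps split: if_splits)
      have "u * (Re q - Re p) = x - Re p"
        unfolding u_def using ne by simp
      moreover have "h x = Im p + u * (Im q - Im p)"
        unfolding u_def h_def \<kappa>_def by simp
      ultimately have "Complex x (h x) = (1 - u) *\<^sub>R p + u *\<^sub>R q"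
        by (simp add: complex_eq_iff algebra_simps)
      then have "Complex x (h x) \<in> closed_segment p q"
        using u unfolding in_segment by blast
      then show ?thesis using assms by blast
    qed
    have in_region: "Complex (real i) (h (real i)) \<in> region" if "j \<le> i" "i \<le> Suc (Suc j)" for i
      using on[of "real i"] j(1) jj that unfolding nodes_between_def by auto
    have avg: "2 * h (real (Suc j)) = h (real j) + h (real (Suc (Suc j)))"
      unfolding h_def by (simp add: algebra_simps)
    have neg: "h (real i) < 0" if "j \<le> i" "i \<le> Suc (Suc j)" "even i" for i
      using region_even_node[OF in_region[OF that(1,2)] _ that(3)] by simp
    have pos: "0 < h (real i)" if "j \<le> i" "i \<le> Suc (Suc j)" "odd i" for i
      using region_odd_node[OF in_region[OF that(1,2)] _ that(3)] by simp
    show False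
    proof (cases "even j")
      case True
      then have "h (real j) < 0" "0 < h (real (Suc j))" "h (real (Suc (Suc j))) < 0"
        using neg[of j] pos[of "Suc j"] neg[of "Suc (Suc j)"] by simp_all
      then show False using avg by linarith
    next
      case False
      then have "0 < h (real j)" "h (real (Suc j)) < 0" "0 < h (real (Suc (Suc j)))"
        using pos[of j] neg[of "Suc j"] pos[of "Suc (Suc j)"] by simp_all
      then show False using avg by linarith
    qed
  qed
  \<comment> \<open>\<open>nodes_between\<close> is a run of consecutive integers, so without
    \<open>j + 2\<close> it stops before it.\<close>
  then have "i < Suc (Suc j)" if "i \<in> nodes_between p q" for i
    using j(1) that unfolding nodes_between_def by auto
  then have "nodes_between p q \<subseteq> {j, Suc j}"
    using j(2) by fastforce
  then show ?thesis
    using card_mono[of "{j, Suc j}" "nodes_between p q"] by auto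
qed simp

lemma card_nodes_between_polygonal_path:
  assumes "xs \<noteq> []" "path_image (polygonal_path xs) \<subseteq> region"
  shows "card (nodes_between (hd xs) (pathfinish (polygonal_path xs))) \<le> 2 * (length xs - 1)"
  using assms
proof (induction xs rule: polygonal_path.induct)
  case (2 x)
  have "nodes_between x x = {}" unfolding nodes_between_def by auto
  then show ?case by (simp add: pathfinish_def)
next
  case (3 x y)
  then show ?case using card_nodes_between_segment[of x y] by simp
next
  case (4 x y z xs)
  have join: "pathfinish (linepath x y) = pathstart (polygonal_path (y # z # xs))"
    using pathstart_polygonal_path[of "y # z # xs"] by simp
  have "closed_segment x y \<subseteq> region" "path_image (polygonal_path (y # z # xs)) \<subseteq> region"
    using 4(3) path_image_join[OF join] by auto
  then show ?case
    using 4(1) card_nodes_between_segment[of x y]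
      card_nodes_between_triangle[of x "pathfinish (polygonal_path (y # z # xs))" y] by simp
qed simp

lemma card_nodes_between_le_geodesic_complexity:
  "enat (card (nodes_between p q)) \<le> 2 * geodesic_complexity region p q"
  unfolding geodesic_complexity_def
proof (rule enat_le_two_Inf, elim imageE)
  fix x xs
  assume xs: "xs \<in> {xs. xs \<noteq> [] \<and> shortest_path region p q (polygonal_path xs)}"
    and x: "x = enat (length xs - 1)"
  then have "path_image (polygonal_path xs) \<subseteq> region" "hd xs = p" "pathfinish (polygonal_path xs) = q"
    "xs \<noteq> []"
    using pathstart_polygonal_path unfolding shortest_path_def paths_in_def by auto
  then have "card (nodes_between p q) \<le> 2 * (length xs - 1)"
    using card_nodes_between_polygonal_path by blast
  then show "enat (card (nodes_between p q)) \<le> 2 * x"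
    unfolding x by (simp add: numeral_eq_enat)
qed

lemma card_link_nodes_le:
  "enat (card (link_nodes e)) \<le> 2 * link_complexity region e"
  unfolding link_complexity_def
proof (rule enat_le_two_Inf, clarsimp)
  fix p q
  show "enat (card (link_nodes {p, q})) \<le> 2 * geodesic_complexity region p q"
    using card_nodes_between_le_geodesic_complexity link_nodes_pair by simp
qed

lemma sum_card_link_nodes_le:
  assumes "finite E"
  shows "enat (\<Sum>e\<in>E. card (link_nodes e)) \<le> 2 * complexity region E"
proof -
  have "enat (\<Sum>e\<in>E. card (link_nodes e)) = (\<Sum>e\<in>E. enat (card (link_nodes e)))"
    by (simp flip: of_nat_eq_enat)
  also have "\<dots> \<le> (\<Sum>e\<in>E. 2 * link_complexity region e)"
    by (intro sum_mono card_link_nodes_le)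
  also have "\<dots> = 2 * complexity region E"
    unfolding complexity_def by (simp add: sum_distrib_left)
  finally show ?thesis .
qed

text \<open>The path drops vertically from \<open>p\<close> to the lower chain, follows it and rises to \<open>q\<close>.\<close>
lemma geodesic_dist_le:
  assumes jl: "j \<le> N" "l \<le> N" and y: "f j \<le> y" "y \<le> g j" and y': "f l \<le> y'" "y' \<le> g l"
    and K: "\<And>i. min j l \<le> i \<Longrightarrow> i < max j l \<Longrightarrow> \<bar>f (Suc i) - f i\<bar> \<le> K" "0 \<le> K"
  shows "geodesic_dist region (Complex j y) (Complex l y') \<le>
    ennreal ((y - f j) + (y' - f l) + (1 + K) * \<bar>real l - real j\<bar>)"
proof -
  \<comment> \<open>The time interval is cut into thirds: \<open>a\<close> falls from 1 to 0 in the
    first, \<open>c\<close> rises in the second, \<open>b\<close> in the third.\<close>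
  define c where "c t = max 0 (min 1 (3 * t - 1))" for t :: real
  define a where "a t = max 0 (1 - 3 * t)" for t :: real
  define b where "b t = max 0 (3 * t - 2)" for t :: real
  define x where "x t = real j + (real l - real j) * c t" for t
  define \<gamma> where "\<gamma> t = Complex (x t) (F (x t) + (y - f j) * a t + (y' - f l) * b t)" for t
  \<comment> \<open>An upper bound, up to a constant, for the length travelled so far, measured by
    horizontal plus vertical change; hence the factor \<open>1 + K\<close>. As \<open>a\<close>
    decreases, it enters with a minus sign.\<close>
  define \<phi> where
    "\<phi> t = (1 + K) * (\<bar>real l - real j\<bar> * c t) - (y - f j) * a t + (y' - f l) * b t" for t
  have node: "F (real j) = f j" "F (real l) = f l" "G (real j) = g j" "G (real l) = g l"
    using jl interp_node N_pos by auto
  have c01: "0 \<le> c t" "c t \<le> 1" for t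
    unfolding c_def by auto
  have x_range: "x t \<in> {real (min j l)..real (max j l)}" for t
  proof (cases "j \<le> l")
    case True
    then have "0 \<le> (real l - real j) * c t" "(real l - real j) * c t \<le> real l - real j"
      using c01[of t] by (auto intro!: mult_nonneg_nonneg mult_left_le)
    then show ?thesis using True unfolding x_def by simp
  next
    case False
    then have "0 \<le> (real j - real l) * c t" "(real j - real l) * c t \<le> real j - real l"
      using c01[of t] by (auto intro!: mult_nonneg_nonneg mult_left_le)
    then show ?thesis using False unfolding x_def by (simp add: algebra_simps)
  qed
  then have x_N: "0 \<le> x t" "x t \<le> real N" for t
    using jl by (smt (verit) atLeastAtMost_iff max_def of_nat_0_le_iff of_nat_le_iff)+
  have cont: "path \<gamma>"
    unfolding path_def \<gamma>_def x_def a_def b_def c_def by (intro continuous_intros)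
  have in_region: "\<gamma> t \<in> region" if t: "0 \<le> t" "t \<le> 1" for t
  proof -
    consider "t \<le> 1 / 3" | "1 / 3 \<le> t" "t \<le> 2 / 3" | "2 / 3 \<le> t"
      by linarith
    then show ?thesis
    proof cases
      case 1
      then have "x t = real j" "b t = 0" "0 \<le> a t" "a t \<le> 1"
        using t unfolding x_def b_def a_def c_def by auto
      moreover from this have "0 \<le> (y - f j) * a t" "(y - f j) * a t \<le> y - f j"
        using y by (auto intro!: mult_nonneg_nonneg mult_left_le)
      ultimately show ?thesis
        using jl y node unfolding region_def \<gamma>_def by auto
    next
      case 2
      then have "a t = 0" "b t = 0" unfolding a_def b_def by auto
      then show ?thesis
        using x_N F_le_G unfolding region_def \<gamma>_def by auto
    next
      case 3
      then have "x t = real l" "a t = 0" "0 \<le> b t" "b t \<le> 1"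
        using t unfolding x_def b_def a_def c_def by auto
      moreover from this have "0 \<le> (y' - f l) * b t" "(y' - f l) * b t \<le> y' - f l"
        using y' by (auto intro!: mult_nonneg_nonneg mult_left_le)
      ultimately show ?thesis
        using jl y' node unfolding region_def \<gamma>_def by auto
    qed
  qed
  have "\<gamma> 0 = Complex j y" "\<gamma> 1 = Complex l y'"
    unfolding \<gamma>_def x_def a_def b_def c_def using node by auto
  then have \<gamma>: "\<gamma> \<in> paths_in region (Complex j y) (Complex l y')"
    using cont in_region unfolding paths_in_def path_image_def pathstart_def pathfinish_def by auto
  have "dist (\<gamma> s) (\<gamma> t) \<le> \<phi> t - \<phi> s" if "0 \<le> s" "s \<le> t" "t \<le> 1" for s t
  proof -
    have "\<bar>x s - x t\<bar> = \<bar>(real l - real j) * (c t - c s)\<bar>"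
      unfolding x_def by (simp add: abs_minus_commute algebra_simps)
    also have "\<dots> = \<bar>real l - real j\<bar> * (c t - c s)"
      using that unfolding abs_mult c_def by auto
    finally have dx: "\<bar>x s - x t\<bar> = \<bar>real l - real j\<bar> * (c t - c s)" .
    have dF: "\<bar>F (x s) - F (x t)\<bar> \<le> K * \<bar>x s - x t\<bar>"
      using x_range jl K by (intro interp_variation[of "min j l" "max j l"]) (auto simp: N_pos)
    have da: "\<bar>(y - f j) * a s - (y - f j) * a t\<bar> = (y - f j) * a s - (y - f j) * a t"
      using that y unfolding a_def by (intro abs_of_nonneg) (auto intro!: mult_left_mono)
    have db: "\<bar>(y' - f l) * b s - (y' - f l) * b t\<bar> = (y' - f l) * b t - (y' - f l) * b s"
      using that y' unfolding b_def abs_minus_commute[of "(y' - f l) * max 0 (3 * s - 2)"]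
      by (intro abs_of_nonneg) (auto intro!: mult_left_mono)
    have "dist (\<gamma> s) (\<gamma> t) \<le> \<bar>Re (\<gamma> s - \<gamma> t)\<bar> + \<bar>Im (\<gamma> s - \<gamma> t)\<bar>"
      unfolding dist_norm by (rule cmod_le)
    also have "\<dots> \<le> \<bar>x s - x t\<bar> + (\<bar>F (x s) - F (x t)\<bar> + \<bar>(y - f j) * a s - (y - f j) * a t\<bar>
        + \<bar>(y' - f l) * b s - (y' - f l) * b t\<bar>)"
      unfolding \<gamma>_def by simp
    also have "\<dots> \<le> \<bar>x s - x t\<bar> + (K * \<bar>x s - x t\<bar> + ((y - f j) * a s - (y - f j) * a t)
        + ((y' - f l) * b t - (y' - f l) * b s))"
      using dF da db by linarith
    also have "\<dots> = \<phi> t - \<phi> s"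
      unfolding \<phi>_def dx by (simp add: algebra_simps)
    finally show ?thesis .
  qed
  then have "curve_length \<gamma> \<le> ennreal (\<phi> 1 - \<phi> 0)"
    by (rule curve_length_le)
  also have "\<phi> 1 - \<phi> 0 = (y - f j) + (y' - f l) + (1 + K) * \<bar>real l - real j\<bar>"
    unfolding \<phi>_def a_def b_def c_def by simp
  finally show ?thesis
    unfolding geodesic_dist_def using \<gamma> by (meson INF_lower order_trans)
qed

end

section \<open>A zigzag with spikes and pits\<close>

text \<open>\<open>2 * z\<close> is the spacing of the sites in nodes, \<open>s\<close> the number
  of sites per block, \<open>H\<close> the height of the sites and \<open>D\<close> the depth of the
  pits; \<open>tip\<close> selects the parity of the number of vertices.\<close>

locale comb =
  fixes N n z s :: nat and H D :: real and tip :: bool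
  assumes z: "1 \<le> z" and s: "1 \<le> s" and n: "1 \<le> n" and zn: "2 * z * n < N"
    and H: "1 < H" and D: "0 < D"
begin

definition q :: nat where "q = 2 * z * s"

definition site_node :: "nat \<Rightarrow> nat" where "site_node a = 2 * z * a + 1"

text \<open>Spikes appear in \<open>high\<close> only: the lower chain has height 1 at every odd
  node and moves by 3 per step away from pits, so it joins the feet of the spikes of a block
  cheaply.\<close>

definition low :: "nat \<Rightarrow> real" where
  "low j = (if odd j then 1 else if q dvd j then - D - 1 else - 2)"

text \<open>At a pit even the upper chain is at or below \<open>- D\<close>, so every path past it
  descends that far.\<close>

definition high :: "nat \<Rightarrow> real" where
  "high j = (if tip \<and> j = N then low j
     else if odd j then (if j \<in> site_node ` {..<n} then H else 2)
     else if q dvd j then - D else - 1)"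

definition site :: "nat \<Rightarrow> complex" where
  "site a = Complex (real (site_node a)) H"

text \<open>Defined for arbitrary points, since Steiner points have to be assigned to blocks
  too.\<close>

definition block :: "complex \<Rightarrow> nat" where
  "block p = nat \<lfloor>Re p\<rfloor> div q"

lemma q_pos: "0 < q" using z s by (simp add: q_def)

lemma low_le_high: "low j \<le> high j"
  using H by (auto simp: low_def high_def)

sublocale zigzag N low high
proof
  show "2 \<le> N"
  proof -
    have "2 * 1 * 1 \<le> 2 * z * n" by (intro mult_mono z n) auto
    then show ?thesis using zn by linarith
  qed
  show "low j < high j" if "j < N" for j
    using that H D by (auto simp: low_def high_def)
  show "low N \<le> high N" by (rule low_le_high)
  show "0 < low j" if "odd j" for j
    using that by (simp add: low_def)
  show "high j < 0" if "even j" for j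
    using that D by (auto simp: low_def high_def)
qed

lemma nverts_comb: "nverts = (if tip then 2 * N + 1 else 2 * N + 2)"
  using D H unfolding nverts_def by (auto simp: low_def high_def)

lemma site_node_mono: "a < b \<Longrightarrow> site_node a + 2 * z \<le> site_node b"
proof -
  assume "a < b"
  then have "2 * z * Suc a \<le> 2 * z * b" by (intro mult_left_mono) auto
  then show ?thesis by (simp add: site_node_def)
qed

lemma site_node_less: "a < n \<Longrightarrow> site_node a < N"
  using site_node_mono[of a n] zn z unfolding site_node_def by linarith

lemma odd_site_node: "odd (site_node a)"
  by (simp add: site_node_def)

lemma low_site_node: "low (site_node a) = 1"
  by (simp add: low_def odd_site_node)

lemma high_site_node: "a < n \<Longrightarrow> high (site_node a) = H"
  using site_node_less[of a] by (auto simp: high_def odd_site_node)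

lemma inj_site: "inj site"
proof (rule injI)
  fix a b assume "site a = site b"
  then have "site_node a = site_node b" by (simp add: site_def)
  then show "a = b" using site_node_mono[of a b] site_node_mono[of b a] z by linarith
qed

lemma site_in_region: "a < n \<Longrightarrow> site a \<in> region"
  using site_node_less[of a] interp_node[of "site_node a" N] low_site_node[of a] high_site_node[of a] H
  unfolding region_def site_def by simp

lemma site_node_div: "site_node a div q = a div s"
proof -
  have "site_node a div (2 * z) = a"
    using z unfolding site_node_def by (intro div_nat_eqI) simp_all
  then show ?thesis unfolding q_def by (simp add: div_mult2_eq)
qed

lemma block_site: "block (site a) = a div s"
  unfolding block_def site_def using site_node_div by simp

text \<open>The node right after the left site is even and lies between the two sites; the region is
  below the real axis there, so each part of the path covers a height of at least
  \<open>H\<close>.\<close>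

lemma geodesic_dist_sites_ge:
  assumes "a \<noteq> b"
  shows "ennreal (2 * H) \<le> geodesic_dist region (site a) (site b)"
proof (rule geodesic_dist_ge_via)
  define c where "c = Suc (site_node (min a b))"
  have "Suc (site_node (min a b)) \<le> site_node (max a b)"
    using site_node_mono[of "min a b" "max a b"] assms z by (auto simp: min_def max_def)
  then show "min (Re (site a)) (Re (site b)) \<le> real c" "real c \<le> max (Re (site a)) (Re (site b))"
    unfolding c_def site_def by (auto simp: min_def max_def split: if_splits)
  fix w assume w: "w \<in> region" "Re w = real c"
  then have "Im w < 0"
    using region_even_node[of w c] odd_site_node by (auto simp: c_def)
  moreover have "\<bar>Im (site a - w)\<bar> \<le> dist (site a) w" "\<bar>Im (w - site b)\<bar> \<le> dist w (site b)"
    unfolding dist_norm by (rule abs_Im_le_cmod)+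
  ultimately show "2 * H \<le> dist (site a) w + dist w (site b)"
    unfolding site_def by simp
qed

text \<open>No pit separates the two sites, so the lower chain has slope at most 3 between them and
  costs at most 4 per node, over at most \<open>q\<close> nodes.\<close>

lemma geodesic_dist_sites_le:
  assumes "a < n" "b < n" "a div s = b div s"
  shows "geodesic_dist region (site a) (site b) \<le> ennreal (2 * H + 4 * real q)"
proof -
  define B where "B = a div s"
  \<comment> \<open>Both bounds are strict because site nodes are odd and \<open>q\<close> is even.
    This keeps both ends of every step between the sites off the pits.\<close>
  have in_block: "q * B < site_node i \<and> site_node i < q * Suc B" if "i div s = B" for i
  proof -
    have "\<not> q dvd site_node i"
      using odd_site_node[of i] dvd_trans[of 2 q "site_node i"] unfolding q_def by auto
    then have "0 < site_node i mod q" by (simp add: mod_greater_zero_iff_not_dvd)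
    moreover have "site_node i = q * B + site_node i mod q"
      using that site_node_div[of i] by (metis mult_div_mod_eq)
    moreover have "site_node i mod q < q" using q_pos by simp
    ultimately show ?thesis by simp
  qed
  note ab = in_block[of a] in_block[of b]
  have no_dvd: "\<not> q dvd i" if "q * B < i" "i < q * Suc B" for i
  proof
    assume "q dvd i"
    then obtain r where "i = q * r" by blast
    then have "B < r" "r < Suc B"
      using that by (simp_all del: mult_Suc_right)
    then show False by simp
  qed
  have incr: "\<bar>low (Suc i) - low i\<bar> \<le> 3"
    if "min (site_node a) (site_node b) \<le> i" "i < max (site_node a) (site_node b)" for i
  proof -
    have "q * B < i" "Suc i < q * Suc B"
      using that ab assms(3) unfolding B_def by auto
    then have "\<not> q dvd i" "\<not> q dvd Suc i"
      using no_dvd by auto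
    then show ?thesis by (simp add: low_def)
  qed
  have "geodesic_dist region (site a) (site b) \<le>
      ennreal ((H - low (site_node a)) + (H - low (site_node b)) +
        (1 + 3) * \<bar>real (site_node b) - real (site_node a)\<bar>)"
    unfolding site_def using assms site_node_less[of a] site_node_less[of b] H incr
    by (intro geodesic_dist_le) (auto simp: low_site_node high_site_node)
  also have "\<dots> \<le> ennreal (2 * H + 4 * real q)"
  proof (rule ennreal_leI)
    have "\<bar>real (site_node b) - real (site_node a)\<bar> \<le> real q"
      using ab assms(3) unfolding B_def by (auto simp: abs_if algebra_simps)
    then show "(H - low (site_node a)) + (H - low (site_node b)) +
        (1 + 3) * \<bar>real (site_node b) - real (site_node a)\<bar> \<le> 2 * H + 4 * real q"
      by (simp add: low_site_node)
  qed
  finally show ?thesis .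
qed

text \<open>The crude slope bound \<open>D + 4\<close> admits pits. Finiteness is what makes the
  spanner condition force a walk between any two sites.\<close>

lemma geodesic_dist_sites_finite:
  assumes "a < n" "b < n"
  shows "geodesic_dist region (site a) (site b) < \<infinity>"
proof -
  have "geodesic_dist region (site a) (site b) \<le>
      ennreal ((H - low (site_node a)) + (H - low (site_node b)) +
        (1 + (D + 4)) * \<bar>real (site_node b) - real (site_node a)\<bar>)"
    unfolding site_def using assms site_node_less[of a] site_node_less[of b] H D
    by (intro geodesic_dist_le) (auto simp: low_site_node high_site_node low_def)
  also have "\<dots> < \<infinity>" by simp
  finally show ?thesis .
qed

text \<open>One of the two pits that bound the block, at \<open>q * B\<close> or
  \<open>q * Suc B\<close>, has to be reached from height \<open>H\<close>.\<close>

lemma geodesic_dist_leave_block: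
  assumes "a < n" "v \<in> region" "block v \<noteq> a div s"
  shows "ennreal D \<le> geodesic_dist region (site a) v"
proof -
  define B where "B = a div s"
  have a: "q * B \<le> site_node a" "site_node a < q * Suc B"
    using site_node_div[of a] q_pos div_times_less_eq_dividend[of "site_node a" q]
      dividend_less_div_times[of q "site_node a"] unfolding B_def by (auto simp: mult.commute)
  have Rev: "0 \<le> Re v" using assms(2) by (simp add: region_def)
  obtain c where c: "q dvd c" "min (Re (site a)) (Re v) \<le> real c" "real c \<le> max (Re (site a)) (Re v)"
  proof (cases "block v < B")
    case True
    then have "nat \<lfloor>Re v\<rfloor> < q * B"
      using q_pos unfolding block_def by (simp add: div_less_iff_less_mult mult.commute)
    then have "Re v < real (q * B)"
      using Rev by linarith
    then show ?thesis
      using a(1) by (intro that[of "q * B"]) (auto simp: site_def simp flip: of_nat_mult)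
  next
    case False
    then have "Suc B \<le> block v" using assms(3) unfolding B_def by linarith
    then have "q * Suc B \<le> nat \<lfloor>Re v\<rfloor>"
      using q_pos unfolding block_def by (simp add: less_eq_div_iff_mult_less_eq mult.commute)
    then have "real (q * Suc B) \<le> Re v"
      using Rev by linarith
    then show ?thesis
      using a(2) by (intro that[of "q * Suc B"]) (auto simp: site_def simp flip: of_nat_mult)
  qed
  have "even c" using c(1) unfolding q_def by (metis dvd_mult_left)
  show ?thesis
  proof (rule geodesic_dist_ge_via[OF c(2,3)])
    fix w assume w: "w \<in> region" "Re w = real c"
    have "low c \<le> - D"
      using c(1) \<open>even c\<close> by (simp add: low_def)
    then have "high c \<le> - D"
    proof (cases "tip \<and> c = N")
      case True
      then have "high c = low c" unfolding high_def by (rule if_P)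
      then show ?thesis using \<open>low c \<le> - D\<close> by simp
    next
      case False
      then show ?thesis using c(1) \<open>even c\<close> unfolding high_def if_not_P[OF False] by simp
    qed
    then have "Im w \<le> - D"
      using region_node[OF w] by linarith
    moreover have "H - Im w \<le> dist (site a) w"
      using abs_Im_le_cmod[of "site a - w"] unfolding dist_norm by (simp add: site_def)
    ultimately show "D \<le> dist (site a) w + dist w v"
      using H zero_le_dist[of w v] by linarith
  qed
qed

lemma card_link_nodes_sites:
  assumes "a < b"
  shows "card (link_nodes {site a, site b}) = 2 * z * (b - a)"
proof -
  have "nodes_between (site a) (site b) = {site_node a<..site_node b}"
    using site_node_mono[OF assms] unfolding nodes_between_def site_def by auto
  then show ?thesis
    using assms unfolding link_nodes_pair by (simp add: site_node_def diff_mult_distrib2)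
qed

section \<open>Walks confined to a block, and nodes counted over all links\<close>

definition sites :: "complex set" where "sites = site ` {..<n}"

definition block_edges :: "complex set set \<Rightarrow> nat \<Rightarrow> (nat \<times> nat) set" where
  "block_edges E B = {(i, j). i < n \<and> j < n \<and> i div s = B \<and> j div s = B \<and> i \<noteq> j \<and> {site i, site j} \<in> E}"

lemma sym_block_edges: "sym (block_edges E B)"
  unfolding block_edges_def by (auto intro!: symI simp: insert_commute)

lemma finite_block_edges: "finite (block_edges E B)"
  by (rule finite_subset[of _ "{..<n} \<times> {..<n}"]) (auto simp: block_edges_def)

text \<open>Induction along the walk: a link shorter than \<open>D\<close> stays in the block, which
  has no Steiner point, so it ends at another site of the block and costs at least
  \<open>2 * H\<close>.\<close>

lemma walk_in_block:
  assumes sp: "geodesic_spanner region sites T E \<tau>" and free: "B \<notin> block ` T"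
    and "ws \<noteq> []" "hd ws = site a" "a < n" "a div s = B"
    and "\<forall>i<length ws - 1. {ws ! i, ws ! Suc i} \<in> E"
    and "(\<Sum>i<length ws - 1. geodesic_dist region (ws ! i) (ws ! Suc i)) < ennreal D"
  shows "\<exists>b. last ws = site b \<and> (a, b) \<in> block_edges E B ^^ (length ws - 1) \<and>
    of_nat (length ws - 1) * ennreal (2 * H) \<le> (\<Sum>i<length ws - 1. geodesic_dist region (ws ! i) (ws ! Suc i))"
  using assms(3-8)
proof (induction ws arbitrary: a)
  case (Cons x ws)
  show ?case
  proof (cases ws)
    case Nil
    then show ?thesis using Cons.prems by auto
  next
    case (Cons y zs)
    have ws: "ws \<noteq> []" "hd ws = y" "length (x # ws) - 1 = Suc (length ws - 1)" "x = site a"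
      using Cons Cons.prems by auto
    define rest where "rest = (\<Sum>i<length ws - 1. geodesic_dist region (ws ! i) (ws ! Suc i))"
    have total: "(\<Sum>i<length (x # ws) - 1. geodesic_dist region ((x # ws) ! i) ((x # ws) ! Suc i)) =
        geodesic_dist region x y + rest"
      unfolding ws(3) sum.lessThan_Suc_shift rest_def using Cons by simp
    have edges: "{x, y} \<in> E" "\<forall>i<length ws - 1. {ws ! i, ws ! Suc i} \<in> E"
    proof -
      show "{x, y} \<in> E" using Cons.prems(5) Cons by (auto dest: spec[of _ 0])
      show "\<forall>i<length ws - 1. {ws ! i, ws ! Suc i} \<in> E"
      proof (intro allI impI)
        fix i assume "i < length ws - 1"
        then have "Suc i < length (x # ws) - 1" by simp
        then show "{ws ! i, ws ! Suc i} \<in> E" using Cons.prems(5) by fastforce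
      qed
    qed
    have less: "geodesic_dist region x y < ennreal D" "rest < ennreal D"
      using Cons.prems(6) unfolding total
      by (auto intro: le_less_trans[rotated] simp: add_increasing add_increasing2)
    obtain u v where "{x, y} = {u, v}" "u \<in> sites \<union> T" "v \<in> sites \<union> T" "u \<noteq> v"
      using edges(1) sp unfolding geodesic_spanner_def by blast
    then have y: "y \<in> sites \<union> T" "x \<noteq> y"
      by (auto simp: doubleton_eq_iff)
    then have "y \<in> region"
      using sp unfolding geodesic_spanner_def by blast
    then have "block y = B"
      using geodesic_dist_leave_block[of a y] less(1) Cons.prems(3,4) ws(4) by (meson leD)
    then have "y \<in> sites" using y(1) free by blast
    then obtain b where b: "b < n" "y = site b" unfolding sites_def by blast
    then have "b div s = B" using \<open>block y = B\<close> block_site by simp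
    have "a \<noteq> b" using y(2) b(2) ws(4) by blast
    have "(a, b) \<in> block_edges E B"
      unfolding block_edges_def using b \<open>a \<noteq> b\<close> \<open>b div s = B\<close> Cons.prems(3,4) edges(1) ws(4) by simp
    obtain b' where b': "last ws = site b'" "(b, b') \<in> block_edges E B ^^ (length ws - 1)"
        "of_nat (length ws - 1) * ennreal (2 * H) \<le> rest"
      using Cons.IH[of b] ws b \<open>b div s = B\<close> edges(2) less(2) unfolding rest_def by blast
    have "(a, b') \<in> block_edges E B ^^ Suc (length ws - 1)"
      using \<open>(a, b) \<in> _\<close> b'(2) by (rule relpow_Suc_I2)
    moreover have "of_nat (Suc (length ws - 1)) * ennreal (2 * H) \<le> geodesic_dist region x y + rest"
    proof -
      have "ennreal (2 * H) + of_nat (length ws - 1) * ennreal (2 * H) \<le> geodesic_dist region x y + rest"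
        using geodesic_dist_sites_ge[OF \<open>a \<noteq> b\<close>] b' b(2) ws(4) by (intro add_mono) auto
      then show ?thesis by (simp add: distrib_right)
    qed
    ultimately show ?thesis
      using b'(1) ws(1) unfolding total unfolding ws(3) by auto
  qed
qed simp

text \<open>The two inequalities act differently: the first makes a walk of \<open>h + 1\<close>
  hops too long, the second keeps every walk within the budget inside the block.\<close>

lemma hop_diameter_block:
  fixes h :: nat
  assumes sp: "geodesic_spanner region sites T E \<tau>" and free: "B \<notin> block ` T"
    and "s * Suc B \<le> n" and "0 \<le> \<tau>"
    and \<tau>: "\<tau> * (2 * H + 4 * real q) < real (Suc h) * (2 * H)" "real (Suc h) * (2 * H) \<le> D"
  shows "hop_diameter_le {s * B..<s * B + s} (block_edges E B) h"
proof -
  have in_block: "i \<in> {s * B..<s * B + s} \<longleftrightarrow> i div s = B" for i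
  proof
    assume "i \<in> {s * B..<s * B + s}"
    then show "i div s = B" by (intro div_nat_eqI) simp_all
  next
    assume "i div s = B"
    then show "i \<in> {s * B..<s * B + s}"
      using s dividend_less_times_div[of s i] times_div_less_eq_dividend[of s i] by simp
  qed
  have less_n: "i < n" if "i div s = B" for i
    using in_block[of i] that assms(3) by auto
  have "\<exists>d\<le>h. (i, j) \<in> block_edges E B ^^ d" if ij: "i div s = B" "j div s = B" for i j
  proof -
    have "graph_dist region E (site i) (site j) \<le> ennreal \<tau> * geodesic_dist region (site i) (site j)"
      using sp ij less_n unfolding geodesic_spanner_def sites_def by blast
    also have "\<dots> \<le> ennreal \<tau> * ennreal (2 * H + 4 * real q)"
      using ij less_n by (intro mult_left_mono geodesic_dist_sites_le) auto
    also have "\<dots> = ennreal (\<tau> * (2 * H + 4 * real q))"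
      using \<open>0 \<le> \<tau>\<close> by (simp add: ennreal_mult')
    also have "\<dots> < ennreal (real (Suc h) * (2 * H))"
      using \<tau>(1) H by (intro ennreal_lessI) auto
    \<comment> \<open>\<open>graph_dist\<close> is an infimum, so the strict inequality yields an
      actual walk below the budget.\<close>
    finally obtain ws where ws: "ws \<in> walks E (site i) (site j)"
        "(\<Sum>i<length ws - 1. geodesic_dist region (ws ! i) (ws ! Suc i)) < ennreal (real (Suc h) * (2 * H))"
      unfolding graph_dist_def INF_less_iff by blast
    have walk: "ws \<noteq> []" "hd ws = site i" "last ws = site j" "\<forall>i<length ws - 1. {ws ! i, ws ! Suc i} \<in> E"
      using ws(1) unfolding walks_def by blast+
    have "(\<Sum>i<length ws - 1. geodesic_dist region (ws ! i) (ws ! Suc i)) < ennreal D"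
      using ws(2) ennreal_leI[OF \<tau>(2)] by (rule less_le_trans)
    then obtain b where b: "last ws = site b" "(i, b) \<in> block_edges E B ^^ (length ws - 1)"
        "of_nat (length ws - 1) * ennreal (2 * H) \<le> (\<Sum>i<length ws - 1. geodesic_dist region (ws ! i) (ws ! Suc i))"
      using walk_in_block[OF sp free walk(1,2) less_n[OF ij(1)] ij(1) walk(4)] by blast
    have "b = j"
      using b(1) walk(3) injD[OF inj_site] by simp
    have "ennreal (real (length ws - 1) * (2 * H)) = of_nat (length ws - 1) * ennreal (2 * H)"
      using H by (subst ennreal_mult) (auto simp: ennreal_of_nat_eq_real_of_nat)
    also have "\<dots> < ennreal (real (Suc h) * (2 * H))"
      using b(3) ws(2) by (rule le_less_trans)
    finally have "real (length ws - 1) * (2 * H) < real (Suc h) * (2 * H)"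
      using H by (subst (asm) ennreal_less_iff) simp_all
    then have "real (length ws - 1) < real (Suc h)"
      using H by (simp only: mult_less_cancel_right)
    then have "length ws - 1 \<le> h"
      by (simp only: of_nat_less_iff less_Suc_eq_le)
    moreover have "(i, j) \<in> block_edges E B ^^ (length ws - 1)"
      using b(2) unfolding \<open>b = j\<close> .
    ultimately show ?thesis by (intro exI conjI)
  qed
  then have "\<forall>i\<in>{s * B..<s * B + s}. \<forall>j\<in>{s * B..<s * B + s}. \<exists>d\<le>h. (i, j) \<in> block_edges E B ^^ d"
    by (simp only: in_block Ball_def) simp
  moreover have "block_edges E B \<subseteq> {s * B..<s * B + s} \<times> {s * B..<s * B + s}"
  proof (rule subrelI)
    fix i j assume "(i, j) \<in> block_edges E B"
    then have "i div s = B" "j div s = B"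
      by (simp_all add: block_edges_def)
    then show "(i, j) \<in> {s * B..<s * B + s} \<times> {s * B..<s * B + s}"
      by (simp only: mem_Sigma_iff in_block simp_thms)
  qed
  ultimately show ?thesis
    unfolding hop_diameter_le_def by (intro conjI)
qed

lemma finite_spanner: "geodesic_spanner P S T E \<tau> \<Longrightarrow> finite E"
  unfolding geodesic_spanner_def
  by (rule finite_subset[of _ "Pow (S \<union> T)"]) auto

text \<open>Blocks have disjoint edge sets and distinct pairs \<open>i < j\<close> are distinct
  links. A link at index distance \<open>d\<close> passes \<open>2 * z * d\<close> nodes but
  contributes \<open>2 * d\<close> to \<open>total_length\<close>, once per orientation; hence the
  factor \<open>z\<close>.\<close>

lemma sum_block_edges_le:
  assumes "finite E" "finite Bs"
  shows "real z * (\<Sum>B\<in>Bs. total_length (block_edges E B)) \<le> real (\<Sum>e\<in>E. card (link_nodes e))"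
proof -
  define P where "P B = {(i, j) \<in> block_edges E B. i < j}" for B
  have fin: "finite (P B)" for B
    unfolding P_def using finite_block_edges by (rule rev_finite_subset) auto
  have disj: "P B \<inter> P B' = {}" if "B \<noteq> B'" for B B'
    using that unfolding P_def block_edges_def by auto
  define e where "e = (\<lambda>(i, j). {site i, site j})"
  have inj: "inj_on e (\<Union>B\<in>Bs. P B)"
    unfolding e_def P_def
    by (auto intro!: inj_onI simp: doubleton_eq_iff inj_eq[OF inj_site])
  have "real z * (\<Sum>B\<in>Bs. total_length (block_edges E B)) =
      (\<Sum>B\<in>Bs. \<Sum>(i, j)\<in>P B. 2 * real z * (real j - real i))"
    unfolding P_def sum_distrib_left
    by (simp add: total_length_sym[OF finite_block_edges sym_block_edges] sum_distrib_left
        case_prod_unfold mult.assoc mult.left_commute)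
  also have "\<dots> = (\<Sum>(i, j)\<in>(\<Union>B\<in>Bs. P B). 2 * real z * (real j - real i))"
    using assms(2) fin disj by (intro sum.UNION_disjoint[symmetric]) auto
  also have "\<dots> = (\<Sum>p\<in>(\<Union>B\<in>Bs. P B). real (card (link_nodes (e p))))"
    unfolding P_def e_def
    by (intro sum.cong) (auto simp: card_link_nodes_sites of_nat_diff)
  also have "\<dots> = (\<Sum>l\<in>e ` (\<Union>B\<in>Bs. P B). real (card (link_nodes l)))"
    using inj by (simp add: sum.reindex)
  also have "\<dots> \<le> (\<Sum>l\<in>E. real (card (link_nodes l)))"
    using assms(1) by (intro sum_mono2) (auto simp: e_def P_def block_edges_def)
  finally show ?thesis by simp
qed

lemma nodes_between_walk:
  assumes "ws \<noteq> []" "\<forall>i<length ws - 1. {ws ! i, ws ! Suc i} \<in> E"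
  shows "nodes_between (hd ws) (last ws) \<subseteq> (\<Union>e\<in>E. link_nodes e)"
  using assms
proof (induction ws)
  case (Cons x ws)
  show ?case
  proof (cases ws)
    case Nil
    then show ?thesis by (auto simp: nodes_between_def)
  next
    case (Cons y zs)
    have "{x, y} \<in> E" using Cons.prems(2) Cons by (auto dest: spec[of _ 0])
    then have 1: "nodes_between x y \<subseteq> (\<Union>e\<in>E. link_nodes e)"
      using link_nodes_pair by blast
    have "\<forall>i<length ws - 1. {ws ! i, ws ! Suc i} \<in> E"
    proof (intro allI impI)
      fix i assume "i < length ws - 1"
      then have "Suc i < length (x # ws) - 1" by simp
      then show "{ws ! i, ws ! Suc i} \<in> E" using Cons.prems(2) by fastforce
    qed
    then have "nodes_between y (last ws) \<subseteq> (\<Union>e\<in>E. link_nodes e)"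
      using Cons.IH Cons by simp
    then show ?thesis
      using 1 nodes_between_triangle[of x "last ws" y] Cons by auto
  qed
qed simp

text \<open>For the case \<open>n < 4 * k\<close>: the links of a walk from the first to the last
  site pass all nodes in between, whatever \<open>\<tau>\<close> is.\<close>

lemma sum_card_ge_connected:
  assumes sp: "geodesic_spanner region sites T E \<tau>"
  shows "2 * z * (n - 1) \<le> (\<Sum>e\<in>E. card (link_nodes e))"
proof (cases "n = 1")
  case False
  have n1: "0 < n" "n - 1 < n" "0 < n - 1" using n False by auto
  have "graph_dist region E (site 0) (site (n - 1)) \<le>
      ennreal \<tau> * geodesic_dist region (site 0) (site (n - 1))"
    using sp n1 unfolding geodesic_spanner_def sites_def by blast
  also have "\<dots> < \<infinity>"
    using geodesic_dist_sites_finite[OF n1(1,2)] by (simp add: ennreal_mult_less_top)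
  finally obtain ws where "ws \<in> walks E (site 0) (site (n - 1))"
    unfolding graph_dist_def INF_less_iff by blast
  then have "nodes_between (site 0) (site (n - 1)) \<subseteq> (\<Union>e\<in>E. link_nodes e)"
    using nodes_between_walk[of ws E] unfolding walks_def by auto
  moreover have fin: "finite E" using sp by (rule finite_spanner)
  moreover have "finite (link_nodes e)" if "e \<in> E" for e
  proof -
    have "e \<in> {{u, v} | u v. u \<in> sites \<union> T \<and> v \<in> sites \<union> T \<and> u \<noteq> v}"
      using that sp unfolding geodesic_spanner_def by (elim conjE) (rule subsetD)
    then obtain u v where "e = {u, v}" by blast
    then show ?thesis using link_nodes_pair finite_nodes_between by simp
  qed
  ultimately have "card (nodes_between (site 0) (site (n - 1))) \<le> card (\<Union>e\<in>E. link_nodes e)"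
    by (intro card_mono) auto
  also have "\<dots> \<le> (\<Sum>e\<in>E. card (link_nodes e))"
    using fin by (rule card_UN_le)
  finally show ?thesis
    using card_link_nodes_sites[OF n1(3)] unfolding link_nodes_pair by simp
qed simp

lemma card_sites: "card sites = n" "finite sites" "sites \<subseteq> region"
  unfolding sites_def using inj_site site_in_region
  by (auto simp: card_image inj_on_def dest: injD)

end

section \<open>Choice of parameters and the three bounds\<close>

lemma spanner_lower_bound_mono:
  "spanner_lower_bound n m k \<tau> b \<Longrightarrow> b' \<le> b \<Longrightarrow> spanner_lower_bound n m k \<tau> b'"
proof -
  assume b: "spanner_lower_bound n m k \<tau> b" "b' \<le> b"
  then obtain vs S where vs: "simple_polygon vs" "length vs = m" "finite S" "card S = n"
      "S \<subseteq> polygon_region vs"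
    and bound: "\<And>T E. geodesic_spanner (polygon_region vs) S T E \<tau> \<and> card T = k \<Longrightarrow>
      ereal b \<le> ereal_of_enat (complexity (polygon_region vs) E)"
    unfolding spanner_lower_bound_def by auto
  have "ereal b' \<le> ereal_of_enat (complexity (polygon_region vs) E)"
    if "geodesic_spanner (polygon_region vs) S T E \<tau> \<and> card T = k" for T E
    using bound[OF that] b(2) order_trans[of "ereal b'" "ereal b"] by simp
  then show ?thesis
    unfolding spanner_lower_bound_def using vs by (intro exI[of _ vs] exI[of _ S]) simp
qed

lemma card_free_blocks:
  assumes "finite T" "card T = k"
  shows "k \<le> card ({..<2 * k} - g ` T)"
proof -
  have "card (g ` T) \<le> k"
    using card_image_le[OF assms(1), of g] assms(2) by simp
  then show ?thesis
    using diff_card_le_card_Diff[of "g ` T" "{..<2 * k}"] assms(1) by simp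
qed

text \<open>The common form of the three claims. \<open>2048 = 16 * 64 * 2\<close> collects
  \<open>m \<le> 16 * n * z\<close>, \<open>s \<ge> n / (4 * k)\<close> raised to
  \<open>\<beta> \<le> 3\<close>, and two nodes per segment. \<open>512 = 16 * 16 * 2\<close>
  collects the same first factor, \<open>(n / k) powr (\<beta> - 1) \<le> 16\<close> and
  \<open>n \<le> 2 * (n - 1)\<close>.\<close>

lemma spanner_lower_bound_hop:
  fixes \<epsilon> \<beta> c :: real and h :: nat
  assumes \<epsilon>: "0 < \<epsilon>" "\<epsilon> < 1" and h: "1 \<le> h" and \<beta>: "1 \<le> \<beta>" "\<beta> \<le> 3" and "0 < c"
    and hop: "\<And>l s A. hop_diameter_le {l..<l + s} A h \<Longrightarrow> 2 \<le> s \<Longrightarrow> sym A \<Longrightarrow>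
      c * real s powr \<beta> \<le> total_length A"
    and nk: "2 \<le> n" "0 < k" "k < n" and m: "16 * n \<le> m"
  shows "spanner_lower_bound n m k (real (Suc h) - \<epsilon>)
    (min (c / 2048) (1 / 512) * real m * (real n / real k) powr (\<beta> - 1))"
proof -
  \<comment> \<open>\<open>m\<close> is \<open>2 * N + 1\<close> or \<open>2 * N + 2\<close>, and
    \<open>z\<close> is the largest value with \<open>2 * z * n < N\<close>.\<close>
  define N where "N = (m - 1) div 2"
  define z where "z = (N - 1) div (2 * n)"
  \<comment> \<open>For \<open>n < 4 * k\<close> the quotient would be below 2; the value 1 is a
    default, as connectedness then gives the bound.\<close>
  define s where "s = (if 4 * k \<le> n then n div (2 * k) else 1)"
  \<comment> \<open>Chosen so that the gain \<open>2 * \<epsilon> * H\<close> exceeds the loss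
    \<open>4 * Suc h * q\<close> caused by the detour \<open>4 * q\<close>; \<open>D\<close> is the
    price of \<open>h + 1\<close> links.\<close>
  define H where "H = 2 * real (Suc h) * real (2 * z * s) / \<epsilon> + 2"
  define D where "D = real (Suc h) * (2 * H)"
  define c' where "c' = min (c / 2048) (1 / 512)"
  have N: "2 * n + 1 \<le> N" "m \<le> 4 * (N - 1)"
    using m nk unfolding N_def by linarith+
  have z: "1 \<le> z" "2 * n * z \<le> N - 1"
    using N nk unfolding z_def by (auto simp: less_eq_div_iff_mult_less_eq)
  have "N - 1 < 2 * n * Suc z"
    using nk dividend_less_times_div[of "2 * n" "N - 1"] unfolding z_def by simp
  also have "\<dots> \<le> 2 * n * (2 * z)"
    using z(1) by (intro mult_left_mono) auto
  finally have "m \<le> 16 * n * z"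
    using N(2) by linarith
  then have zm: "real m \<le> 16 * real n * real z"
    by (metis of_nat_le_iff of_nat_mult of_nat_numeral)
  have s1: "1 \<le> s"
    using nk unfolding s_def by (auto simp: less_eq_div_iff_mult_less_eq)
  have H2: "2 \<le> H"
    using \<epsilon> unfolding H_def by simp
  have "0 < D" using H2 unfolding D_def by simp
  interpret comb N n z s H D "odd m"
    using z s1 nk N H2 \<open>0 < D\<close> by unfold_locales (auto simp: mult.commute mult.left_commute)
  have "m = (if odd m then 2 * N + 1 else 2 * N + 2)"
    using m nk unfolding N_def by presburger
  then have nv: "nverts = m"
    unfolding nverts_comb by simp
  have \<tau>: "(real (Suc h) - \<epsilon>) * (2 * H + 4 * real q) < real (Suc h) * (2 * H)"
  proof -
    define r where "r = real (Suc h)"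
    have "\<epsilon> * H = 2 * (r * real q) + 2 * \<epsilon>"
      using \<epsilon> unfolding H_def q_def r_def by (simp add: field_simps)
    moreover have "0 \<le> \<epsilon> * real q" using \<epsilon> by simp
    ultimately have "4 * (r * real q) < 2 * (\<epsilon> * H) + 4 * (\<epsilon> * real q)"
      using \<epsilon> by linarith
    moreover have "(r - \<epsilon>) * (2 * H + 4 * real q) =
        r * (2 * H) + 4 * (r * real q) - 2 * (\<epsilon> * H) - 4 * (\<epsilon> * real q)"
      by (simp add: algebra_simps)
    ultimately show ?thesis unfolding r_def[symmetric] by linarith
  qed
  have ratio: "1 \<le> real n / real k"
    using nk by simp
  have bound: "c' * real m * (real n / real k) powr (\<beta> - 1) \<le> real (\<Sum>e\<in>E. card (link_nodes e)) / 2"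
    if sp: "geodesic_spanner region sites T E (real (Suc h) - \<epsilon>)" and T: "card T = k" for T E
  proof (cases "4 * k \<le> n")
    case True
    define Bs where "Bs = {..<2 * k} - block ` T"
    have finT: "finite T" and finE: "finite E"
      using sp finite_spanner unfolding geodesic_spanner_def by blast+
    have kBs: "k \<le> card Bs"
      unfolding Bs_def using finT T by (rule card_free_blocks)
    have s_def': "s = n div (2 * k)" using True by (simp add: s_def)
    have s2: "2 \<le> s"
      using True nk unfolding s_def' by (simp add: less_eq_div_iff_mult_less_eq)
    have sn: "2 * k * s \<le> n"
      unfolding s_def' by simp
    have "n < 2 * k * Suc s"
      using nk dividend_less_times_div[of "2 * k" n] unfolding s_def' by simp
    also have "\<dots> \<le> 2 * k * (2 * s)"
      using s1 by (intro mult_left_mono) auto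
    finally have "real n \<le> 4 * real k * real s"
      by (metis (no_types, lifting) less_imp_le mult.assoc mult.left_commute mult_2 of_nat_add
          of_nat_le_iff of_nat_mult of_nat_numeral numeral_Bit0)
    then have s_ge: "real n / real k / 4 \<le> real s"
      using nk by (simp add: field_simps)
    have each: "c * real s powr \<beta> \<le> total_length (block_edges E B)" if "B \<in> Bs" for B
    proof (rule hop[OF _ s2 sym_block_edges])
      have "s * Suc B \<le> s * (2 * k)"
        using that unfolding Bs_def by (intro mult_left_mono) auto
      then have "s * Suc B \<le> n" using sn by (simp add: mult.commute)
      then show "hop_diameter_le {s * B..<s * B + s} (block_edges E B) h"
        using sp that \<tau> \<epsilon> unfolding Bs_def by (intro hop_diameter_block) (auto simp: D_def)
    qed
    have "(real n / real k) powr \<beta> = 4 powr \<beta> * (real n / real k / 4) powr \<beta>"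
      using powr_mult[of 4 "real n / real k / 4" \<beta>] by simp
    also have "\<dots> \<le> 4 powr 3 * real s powr \<beta>"
      using s_ge \<beta> nk by (intro mult_mono powr_mono powr_mono2) auto
    also have "4 powr 3 = (64 :: real)"
      using powr_realpow[of 4 3] by simp
    finally have pw: "(real n / real k) powr \<beta> \<le> 64 * real s powr \<beta>" .
    have "c' * real m * (real n / real k) powr (\<beta> - 1) \<le>
        c / 2048 * (16 * real n * real z) * (real n / real k) powr (\<beta> - 1)"
      using zm \<open>0 < c\<close> unfolding c'_def by (intro mult_right_mono mult_mono) auto
    also have "\<dots> = c / 128 * real z * real k * ((real n / real k) powr (\<beta> - 1) * (real n / real k))"
      using nk by (simp add: field_simps)
    also have "(real n / real k) powr (\<beta> - 1) * (real n / real k) = (real n / real k) powr \<beta>"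
      using nk powr_add[of "real n / real k" "\<beta> - 1" 1] by simp
    also have "c / 128 * real z * real k * (real n / real k) powr \<beta> \<le>
        c / 128 * real z * real k * (64 * real s powr \<beta>)"
      using pw \<open>0 < c\<close> by (intro mult_left_mono) auto
    also have "\<dots> = real z * (real k * (c * real s powr \<beta>)) / 2"
      by simp
    also have "\<dots> \<le> real z * (real (card Bs) * (c * real s powr \<beta>)) / 2"
      using kBs \<open>0 < c\<close> by (intro divide_right_mono mult_left_mono mult_right_mono) auto
    also have "\<dots> = real z * (\<Sum>B\<in>Bs. c * real s powr \<beta>) / 2"
      by simp
    also have "\<dots> \<le> real z * (\<Sum>B\<in>Bs. total_length (block_edges E B)) / 2"
      by (intro divide_right_mono mult_left_mono sum_mono each) auto
    also have "\<dots> \<le> real (\<Sum>e\<in>E. card (link_nodes e)) / 2"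
      using sum_block_edges_le[OF finE, of Bs] by (simp add: Bs_def)
    finally show ?thesis .
  next
    case False
    \<comment> \<open>The power of \<open>n / k\<close> is bounded here, and a connected spanner
      already has complexity of order \<open>m\<close>.\<close>
    have "real n / real k \<le> 4"
      using False nk by (simp add: field_simps)
    then have "(real n / real k) powr (\<beta> - 1) \<le> 4 powr (\<beta> - 1)"
      using ratio \<beta> by (intro powr_mono2) auto
    also have "\<dots> \<le> 4 powr 2"
      using \<beta> by (intro powr_mono) auto
    also have "\<dots> = (16 :: real)"
      using powr_realpow[of 4 2] by simp
    finally have pw: "(real n / real k) powr (\<beta> - 1) \<le> 16" .
    have "c' * real m * (real n / real k) powr (\<beta> - 1) \<le> 1 / 512 * (16 * real n * real z) * 16"
      using zm pw \<open>0 < c\<close> unfolding c'_def by (intro mult_mono) auto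
    also have "\<dots> = real z * real n / 2"
      by simp
    also have "\<dots> \<le> real (2 * z * (n - 1)) / 2"
    proof -
      have "z * n \<le> z * (2 * (n - 1))" using nk by (intro mult_left_mono) auto
      then have "z * n \<le> 2 * z * (n - 1)" by (simp add: mult.assoc mult.left_commute)
      then show ?thesis by (metis divide_right_mono of_nat_le_iff of_nat_mult zero_le_numeral)
    qed
    also have "\<dots> \<le> real (\<Sum>e\<in>E. card (link_nodes e)) / 2"
      using sum_card_ge_connected[OF sp] by (intro divide_right_mono of_nat_mono) auto
    finally show ?thesis .
  qed
  have "ereal (c' * real m * (real n / real k) powr (\<beta> - 1)) \<le>
      ereal_of_enat (complexity (polygon_region verts) E)"
    if sp: "geodesic_spanner (polygon_region verts) sites T E (real (Suc h) - \<epsilon>) \<and> card T = k" for T E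
  proof -
    have sp': "geodesic_spanner region sites T E (real (Suc h) - \<epsilon>)"
      using sp unfolding polygon_region_verts by blast
    have two: "enat (\<Sum>e\<in>E. card (link_nodes e)) \<le> 2 * complexity region E"
      using sum_card_link_nodes_le[OF finite_spanner[OF sp']] .
    show ?thesis
    proof (cases "complexity region E")
      case (enat C)
      have "(\<Sum>e\<in>E. card (link_nodes e)) \<le> 2 * C"
        using two unfolding enat by (simp add: numeral_eq_enat)
      then have "real (\<Sum>e\<in>E. card (link_nodes e)) \<le> real (2 * C)"
        by (rule of_nat_mono)
      then have "c' * real m * (real n / real k) powr (\<beta> - 1) \<le> real C"
        using bound[OF sp' conjunct2[OF sp]] by simp
      then show ?thesis unfolding polygon_region_verts enat by simp
    next
      case infinity
      then show ?thesis unfolding polygon_region_verts by simp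
    qed
  qed
  moreover have "length verts = m"
    using nv by (simp add: verts_def)
  ultimately show ?thesis
    unfolding spanner_lower_bound_def c'_def[symmetric]
    using simple_polygon_verts card_sites(1,2) card_sites(3)[folded polygon_region_verts]
    by (intro exI conjI allI impI)
qed

theorem lemma17:
  shows "\<forall>\<epsilon>::real. \<forall>t::nat. 0 < \<epsilon> \<and> \<epsilon> < 1 \<and> t \<ge> 2 \<longrightarrow>
    (\<exists>c C :: real. c > 0 \<and> C > 0 \<and>
      (\<forall>n m k :: nat. n > 0 \<and> m > 0 \<and> k > 0 \<and> real m \<ge> C * real n \<longrightarrow>
        (real k < real n / 2 \<longrightarrow>
           spanner_lower_bound n m k (2 - \<epsilon>) (c * real m * (real n)^2 / (real k)^2)) \<and>
        (real k < real n / 2 \<longrightarrow>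
           spanner_lower_bound n m k (3 - \<epsilon>) (c * real m * real n / real k)) \<and>
        (k < n \<longrightarrow>
           spanner_lower_bound n m k (real t - \<epsilon>)
             (c * real m * real n powr (1 / (real t + 1)) / real k powr (1 / (real t + 1))))))"
proof (intro allI impI)
  fix \<epsilon> :: real and t :: nat
  assume \<epsilon>t: "0 < \<epsilon> \<and> \<epsilon> < 1 \<and> t \<ge> 2"
  \<comment> \<open>The stretch \<open>t - \<epsilon>\<close> leaves room for at most
    \<open>t - 1\<close> hops.\<close>
  define h where "h = t - 1"
  have h: "1 \<le> h" "Suc h = t" "real (h + 2) = real t + 1"
    using \<epsilon>t unfolding h_def by auto
  obtain c0 where "0 < c0" and c0: "\<And>l s A. hop_diameter_le {l..<l + s} A h \<Longrightarrow> 2 \<le> s \<Longrightarrow>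
      c0 * real s powr (1 + 1 / (real t + 1)) \<le> total_length A"
    using total_length_hop[OF h(1)] unfolding h(3) by blast
  define \<beta> where "\<beta> = 1 + 1 / (real t + 1)"
  have \<beta>: "1 \<le> \<beta>" "\<beta> \<le> 3" "\<beta> - 1 = 1 / (real t + 1)"
    unfolding \<beta>_def by (auto simp: field_simps)
  \<comment> \<open>\<open>1 / 54\<close> and \<open>1 / 36\<close> are the constants for one and
    two hops; a single \<open>c\<close> has to serve all three claims.\<close>
  define c1 c2 c3 where "c1 = min ((1 / 54) / 2048) (1 / 512 :: real)"
    and "c2 = min ((1 / 36) / 2048) (1 / 512 :: real)" and "c3 = min (c0 / 2048) (1 / 512)"
  define c where "c = min c1 (min c2 c3)"
  have c: "0 < c" "c \<le> c1" "c \<le> c2" "c \<le> c3"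
    unfolding c_def c1_def c2_def c3_def using \<open>0 < c0\<close> by auto
  have "(real k < real n / 2 \<longrightarrow>
           spanner_lower_bound n m k (2 - \<epsilon>) (c * real m * (real n)^2 / (real k)^2)) \<and>
        (real k < real n / 2 \<longrightarrow>
           spanner_lower_bound n m k (3 - \<epsilon>) (c * real m * real n / real k)) \<and>
        (k < n \<longrightarrow>
           spanner_lower_bound n m k (real t - \<epsilon>)
             (c * real m * real n powr (1 / (real t + 1)) / real k powr (1 / (real t + 1))))"
    if nmk: "n > 0 \<and> m > 0 \<and> k > 0 \<and> real m \<ge> 16 * real n" for n m k :: nat
  proof (intro conjI impI)
    have m: "16 * n \<le> m" using nmk by linarith
    show "spanner_lower_bound n m k (2 - \<epsilon>) (c * real m * (real n)^2 / (real k)^2)"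
      if "real k < real n / 2"
    proof -
      have "2 \<le> n" "0 < k" "k < n" using that nmk by linarith+
      then have main: "spanner_lower_bound n m k (real (Suc 1) - \<epsilon>)
          (c1 * real m * (real n / real k) powr (3 - 1))"
        unfolding c1_def using \<epsilon>t m total_length_hop1
        by (intro spanner_lower_bound_hop) (auto simp: powr_numeral)
      have "c * (real m * (real n / real k)\<^sup>2) \<le> c1 * (real m * (real n / real k)\<^sup>2)"
        using c by (intro mult_right_mono) auto
      then have le: "c * real m * (real n)^2 / (real k)^2 \<le> c1 * real m * (real n / real k) powr (3 - 1)"
        using \<open>2 \<le> n\<close> by (simp add: power_divide mult.assoc)
      have "real (Suc 1) - \<epsilon> = 2 - \<epsilon>" by simp
      from main[unfolded this] le show ?thesis
        by (rule spanner_lower_bound_mono)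
    qed
    show "spanner_lower_bound n m k (3 - \<epsilon>) (c * real m * real n / real k)"
      if "real k < real n / 2"
    proof -
      have "2 \<le> n" "0 < k" "k < n" using that nmk by linarith+
      then have main: "spanner_lower_bound n m k (real (Suc 2) - \<epsilon>)
          (c2 * real m * (real n / real k) powr (2 - 1))"
        unfolding c2_def using \<epsilon>t m total_length_hop2
        by (intro spanner_lower_bound_hop) (auto simp: powr_numeral)
      have "c * (real m * (real n / real k)) \<le> c2 * (real m * (real n / real k))"
        using c by (intro mult_right_mono) auto
      then have le: "c * real m * real n / real k \<le> c2 * real m * (real n / real k) powr (2 - 1)"
        using \<open>2 \<le> n\<close> by (simp add: mult.assoc)
      have "real (Suc 2) - \<epsilon> = 3 - \<epsilon>" by simp
      from main[unfolded this] le show ?thesis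
        by (rule spanner_lower_bound_mono)
    qed
    show "spanner_lower_bound n m k (real t - \<epsilon>)
        (c * real m * real n powr (1 / (real t + 1)) / real k powr (1 / (real t + 1)))"
      if "k < n"
    proof (rule spanner_lower_bound_mono)
      have "2 \<le> n" "0 < k" using that nmk by linarith+
      then show "spanner_lower_bound n m k (real t - \<epsilon>)
          (c3 * real m * (real n / real k) powr (\<beta> - 1))"
        unfolding c3_def h(2)[symmetric] using \<epsilon>t m that \<beta> h(1) \<open>0 < c0\<close> c0
        by (intro spanner_lower_bound_hop) (auto simp: \<beta>_def)
      have "c * (real m * (real n / real k) powr (\<beta> - 1)) \<le> c3 * (real m * (real n / real k) powr (\<beta> - 1))"
        using c by (intro mult_right_mono) auto
      then show "c * real m * real n powr (1 / (real t + 1)) / real k powr (1 / (real t + 1)) \<le>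
          c3 * real m * (real n / real k) powr (\<beta> - 1)"
        unfolding \<beta>(3) by (simp add: powr_divide mult.assoc)
    qed
  qed
  then show "\<exists>c C :: real. c > 0 \<and> C > 0 \<and>
      (\<forall>n m k :: nat. n > 0 \<and> m > 0 \<and> k > 0 \<and> real m \<ge> C * real n \<longrightarrow>
        (real k < real n / 2 \<longrightarrow>
           spanner_lower_bound n m k (2 - \<epsilon>) (c * real m * (real n)^2 / (real k)^2)) \<and>
        (real k < real n / 2 \<longrightarrow>
           spanner_lower_bound n m k (3 - \<epsilon>) (c * real m * real n / real k)) \<and>
        (k < n \<longrightarrow>
           spanner_lower_bound n m k (real t - \<epsilon>)
             (c * real m * real n powr (1 / (real t + 1)) / real k powr (1 / (real t + 1)))))"
    using c(1) by (intro exI[of _ c] exI[of _ 16]) simp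
qed

end
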